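(* Assume that $u=(u_j)_{j\in\mathbb{Z}^d}$ is a solution to $$\partial_t u_j=i(\Delta_d u_j+V_ju_j),\qquad \Delta_d u_j=\sum_{k=1}^d(u_{j+e_k}-2u_j+u_{j-e_k}),\qquad j\in\mathbb{Z}^d,$$ where $V$ is a time-dependent bounded potential. Then, for $t\in[0,1]$ and $\beta\in\mathbb{R}$, we have $$\sum_{j\in\mathbb{Z}^d}e^{2\beta j_1}|u_j(t)|^2\le e^{C\|V\|_\infty}\sum_{j\in\mathbb{Z}^d}e^{2\beta j_1}\big(|u_j(0)|^2+|u_j(1)|^2\big),$$ where the constant $C$ is independent of $\beta$.
   Context: $e_1,\dots,e_d$ is the standard basis of $\mathbb{Z}^d$ and $j_1$ is the first coordinate of $j=(j_1,\dots,j_d)\in\mathbb{Z}^d$. The potential is $V=(V_j(t))_{j\in\mathbb{Z}^d}$, and $\|V\|_\infty=\sup_{j\in\mathbb{Z}^d,\,t\in[0,1]}|V_j(t)|<\infty$.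
   Formalization: "Solution" is taken to mean a sitewise solution bounded into ℓ² on [0,1], since the sitewise equation alone admits nonzero u with u(0)=u(1)=0; C is independent of β, t, u and uniform over all V with ‖V‖∞ ≤ M, but may depend on M. *)

theory Defs
  imports "HOL-Analysis.Analysis"
begin

text \<open>
  The lattice \<open>\<int>\<^sup>d\<close> is the type \<open>int ^ 'd\<close>, with \<open>d = CARD('d)\<close>; its standard basis is
  \<open>axis k 1\<close>. A time-dependent lattice function \<open>u = (u\<^sub>j(t))\<close> is curried as \<open>u j t\<close>.
\<close>

definition lattice_laplacian :: "(int ^ 'd \<Rightarrow> complex) \<Rightarrow> int ^ 'd \<Rightarrow> complex" where
  "lattice_laplacian w j =
     (\<Sum>k\<in>UNIV. w (j + axis k 1) - 2 * w j + w (j - axis k 1))"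

definition bounded_potential :: "(int ^ 'd \<Rightarrow> real \<Rightarrow> complex) \<Rightarrow> bool" where
  "bounded_potential V \<longleftrightarrow> bdd_above ((\<lambda>(j, t). cmod (V j t)) ` (UNIV \<times> {0..1}))"

text \<open>Meaningful only for a \<open>bounded_potential\<close>, the supremum being taken in \<open>real\<close>.\<close>

definition potential_norm :: "(int ^ 'd \<Rightarrow> real \<Rightarrow> complex) \<Rightarrow> real" where
  "potential_norm V = (SUP (j, t)\<in>UNIV \<times> {0..1}. cmod (V j t))"

text \<open>
  A solution is a function into \<open>\<ell>\<^sup>2(\<int>\<^sup>d)\<close>, bounded on \<open>[0,1]\<close>, that satisfies the equation at
  every site and time (with one-sided derivatives at 0 and 1). Every solution in
  \<open>C([0,1]; \<ell>\<^sup>2)\<close> or \<open>C\<^sup>1([0,1]; \<ell>\<^sup>2)\<close> is one. The equation at every site alone would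
  not do: in one dimension and for \<open>V = 0\<close>, prescribing \<open>u\<^sub>0\<close> and \<open>u\<^sub>1\<close> as arbitrary smooth
  functions with compact support in \<open>(0,1)\<close> and solving for the other \<open>u\<^sub>j\<close> gives nonzero
  functions that satisfy it and vanish at times 0 and 1.
\<close>

definition schroedinger_solution ::
  "(int ^ 'd \<Rightarrow> real \<Rightarrow> complex) \<Rightarrow> (int ^ 'd \<Rightarrow> real \<Rightarrow> complex) \<Rightarrow> bool" where
  "schroedinger_solution V u \<longleftrightarrow>
     (SUP t\<in>{0..1}. \<Sum>\<^sub>\<infinity>j. ennreal ((cmod (u j t))\<^sup>2)) < \<infinity> \<and>
     (\<forall>j. \<forall>t\<in>{0..1}.
        (u j has_vector_derivative
           \<i> * (lattice_laplacian (\<lambda>l. u l t) j + V j t * u j t)) (at t within {0..1}))"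

end

theory Submission
  imports Defs
begin

text \<open>
  Put \<open>v\<^sub>j = exp (\<beta>j\<^sub>1) u\<^sub>j\<close>, where \<open>j\<^sub>1\<close> is the first coordinate. Then \<open>v' = Sv + Av + F\<close> with \<open>F = \<i>Vv\<close> and \<open>S\<close>
  symmetric, \<open>A\<close> skew, both bounded and translation invariant, hence commuting. For
  \<open>H = \<parallel>v\<parallel>\<^sup>2\<close> and the frequency \<open>N = \<langle>v, Sv\<rangle> / H\<close>, with \<open>m = \<parallel>V\<parallel>\<^sub>\<infinity>\<close>, completing the square gives
  \<open>N' \<ge> - m\<^sup>2 / 2\<close> and \<open>\<bar>(ln H)' - 2N\<bar> \<le> 2m\<close>. If \<open>N(t) \<ge> 0\<close>, then \<open>N \<ge> - m\<^sup>2 / 2\<close> on \<open>[t,1]\<close> and \<open>H(t)\<close> is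
  bounded by \<open>H(1)\<close>; otherwise it is bounded by \<open>H(0)\<close>. The factor is \<open>exp (2m + m\<^sup>2)\<close> in both cases,
  which does not depend on \<open>\<beta>\<close>.

  Since \<open>V\<close> is arbitrary in \<open>t\<close>, no integral in time is available. Instead, \<open>H\<close> and \<open>\<langle>v, Sv\<rangle>\<close> are
  differentiated term by term, which needs tails of \<open>\<Sum>\<^sub>j \<bar>v\<^sub>j\<bar>\<^sup>2\<close> that are small uniformly in \<open>t\<close>. They come
  from a Gronwall estimate for weights whose ratios at neighbouring sites are bounded.
\<close>

section \<open>Differential inequalities and logarithmic convexity\<close>

lemma mono_on_Icc_if_deriv_nonneg:
  fixes f :: "real \<Rightarrow> real"
  assumes "\<And>x. x \<in> {a..b} \<Longrightarrow> (f has_real_derivative f' x) (at x within {a..b})"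
    and "\<And>x. x \<in> {a..b} \<Longrightarrow> 0 \<le> f' x"
    and "a \<le> b"
  shows "f a \<le> f b"
proof (rule DERIV_nonneg_imp_increasing_open[OF \<open>a \<le> b\<close>])
  fix x assume "a < x" "x < b"
  then show "\<exists>y. DERIV f x :> y \<and> 0 \<le> y"
    using assms(1,2)[of x] by (auto simp: at_within_Icc_at)
next
  show "continuous_on {a..b} f"
    using assms(1) by (rule DERIV_continuous_on)
qed

text \<open>In the application \<open>H\<close>, \<open>G\<close>, \<open>P\<close>,
  \<open>f\<close>, \<open>g\<close> are the squared norm of v and the pairings of v with Sv, Sv
  with Sv, v with F and Sv with F. Then \<open>quad\<close> is the squared norm of Sv - Nv + F/2,
  expanded, with the squared norm of F replaced by its bound m^2 H. The constant \<open>K\<close>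
  will grow with \<beta>, but it only serves to keep \<open>H\<close> positive and does not enter
  the conclusion.\<close>

lemma log_convexity_bound:
  fixes H G P f g :: "real \<Rightarrow> real"
  assumes dH: "\<And>s. s \<in> {0..1} \<Longrightarrow> (H has_real_derivative 2 * G s + 2 * f s) (at s within {0..1})"
    and dG: "\<And>s. s \<in> {0..1} \<Longrightarrow> (G has_real_derivative 2 * P s + 2 * g s) (at s within {0..1})"
    and H0: "\<And>s. s \<in> {0..1} \<Longrightarrow> 0 \<le> H s"
    and f: "\<And>s. s \<in> {0..1} \<Longrightarrow> \<bar>f s\<bar> \<le> m * H s"
    and G: "\<And>s. s \<in> {0..1} \<Longrightarrow> \<bar>G s\<bar> \<le> K * H s"
    and quad: "\<And>s N. s \<in> {0..1} \<Longrightarrow>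
      0 \<le> P s - 2 * N * G s + N\<^sup>2 * H s + g s - N * f s + m\<^sup>2 / 4 * H s"
    and m: "0 \<le> m" and t: "t \<in> {0..1}"
  shows "H t \<le> exp (2 * m + m\<^sup>2) * (H 0 + H 1)"
proof (cases "H t = 0")
  case True
  then show ?thesis using H0[of 0] H0[of 1] by simp
next
  case False
  then have Ht: "H t > 0" using H0[OF t] by simp
  define L where "L = 2 * K + 2 * m"
  have bd: "\<bar>2 * G s + 2 * f s\<bar> \<le> L * H s" if "s \<in> {0..1}" for s
    using f[OF that] G[OF that] unfolding L_def by (simp add: algebra_simps)
  have dH': "(H has_real_derivative 2 * G s + 2 * f s) (at s within {a..b})"
    if "s \<in> {a..b}" "0 \<le> a" "b \<le> 1" for s a b
    using that by (intro DERIV_subset[OF dH]) auto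
  have dG': "(G has_real_derivative 2 * P s + 2 * g s) (at s within {a..b})"
    if "s \<in> {a..b}" "0 \<le> a" "b \<le> 1" for s a b
    using that by (intro DERIV_subset[OF dG]) auto
  \<comment> \<open>Since the derivative of \<open>H\<close> is at most \<open>L * H\<close> in
    absolute value, \<open>H x * exp (- L * x)\<close> decreases and
    \<open>H x * exp (L * x)\<close> increases. A zero of \<open>H\<close> on either side would
    therefore force \<open>H t = 0\<close>. Positivity permits division by \<open>H\<close> and the
    use of \<open>ln H\<close>.\<close>
  have pos: "H s > 0" if s: "s \<in> {0..1}" for s
  proof (cases "s \<le> t")
    case True
    have "(\<lambda>x. - (H x * exp (- L * x))) s \<le> (\<lambda>x. - (H x * exp (- L * x))) t"
    proof (rule mono_on_Icc_if_deriv_nonneg[OF _ _ True])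
      fix x assume x: "x \<in> {s..t}"
      show "((\<lambda>x. - (H x * exp (- L * x))) has_real_derivative
          (L * H x - (2 * G x + 2 * f x)) * exp (- L * x)) (at x within {s..t})"
        using x s t by (auto intro!: derivative_eq_intros dH' simp: algebra_simps)
      show "0 \<le> (L * H x - (2 * G x + 2 * f x)) * exp (- L * x)"
        using bd[of x] x s t by auto
    qed
    then have "H t * exp (- L * t) \<le> H s * exp (- L * s)" by simp
    then show ?thesis
      using Ht H0[OF s] by (metis exp_gt_zero mult_eq_0_iff mult_pos_pos not_less order_le_less)
  next
    case False
    then have "t \<le> s" by simp
    have "(\<lambda>x. H x * exp (L * x)) t \<le> (\<lambda>x. H x * exp (L * x)) s"
    proof (rule mono_on_Icc_if_deriv_nonneg[OF _ _ \<open>t \<le> s\<close>])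
      fix x assume x: "x \<in> {t..s}"
      show "((\<lambda>x. H x * exp (L * x)) has_real_derivative
          (L * H x + (2 * G x + 2 * f x)) * exp (L * x)) (at x within {t..s})"
        using x s t by (auto intro!: derivative_eq_intros dH' simp: algebra_simps)
      show "0 \<le> (L * H x + (2 * G x + 2 * f x)) * exp (L * x)"
        using bd[of x] x s t by (auto intro!: mult_nonneg_nonneg)
    qed
    then show ?thesis
      using Ht H0[OF s] by (metis exp_gt_zero mult_eq_0_iff mult_pos_pos not_less order_le_less)
  qed
  define N where "N s = G s / H s" for s
  have GN: "G s = N s * H s" if "s \<in> {0..1}" for s
    using pos[OF that] by (simp add: N_def)
  \<comment> \<open>The linear term contributes m^2/2 to the derivative, which is what
    \<open>quad\<close> needs to make it nonnegative.\<close>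
  have dN: "((\<lambda>s. N s + m\<^sup>2 / 2 * s) has_real_derivative
      2 * (P s - N s * G s + g s - N s * f s + m\<^sup>2 / 4 * H s) / H s) (at s within {a..b})"
    if "s \<in> {a..b}" "0 \<le> a" "b \<le> 1" for s a b
  proof -
    have p: "H s > 0" using pos that by auto
    show ?thesis unfolding N_def using p that
      by (auto intro!: derivative_eq_intros dH' dG')
         (simp add: divide_simps, simp add: algebra_simps power2_eq_square)
  qed
  have N_mono: "N a + m\<^sup>2 / 2 * a \<le> N b + m\<^sup>2 / 2 * b" if "0 \<le> a" "a \<le> b" "b \<le> 1" for a b
  proof -
    have "(\<lambda>s. N s + m\<^sup>2 / 2 * s) a \<le> (\<lambda>s. N s + m\<^sup>2 / 2 * s) b"
    proof (rule mono_on_Icc_if_deriv_nonneg[OF _ _ \<open>a \<le> b\<close>])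
      fix s assume s: "s \<in> {a..b}"
      show "((\<lambda>s. N s + m\<^sup>2 / 2 * s) has_real_derivative
        2 * (P s - N s * G s + g s - N s * f s + m\<^sup>2 / 4 * H s) / H s) (at s within {a..b})"
        using s that by (intro dN)
      have s': "s \<in> {0..1}" using s that by auto
      \<comment> \<open>This is \<open>quad\<close> at the frequency itself: there
        \<open>G = N * H\<close>, so -2NG + N^2 H collapses to -NG.\<close>
      have "0 \<le> P s - N s * G s + g s - N s * f s + m\<^sup>2 / 4 * H s"
        using quad[OF s', of "N s"] GN[OF s'] by (simp add: power2_eq_square mult_ac)
      then show "0 \<le> 2 * (P s - N s * G s + g s - N s * f s + m\<^sup>2 / 4 * H s) / H s"
        using pos[OF s'] by (intro divide_nonneg_pos mult_nonneg_nonneg) auto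
    qed
    then show ?thesis by simp
  qed
  have quot: "2 * N s - 2 * m \<le> (2 * G s + 2 * f s) / H s"
    "(2 * G s + 2 * f s) / H s \<le> 2 * N s + 2 * m" if "s \<in> {0..1}" for s
    using pos[OF that] f[OF that] GN[OF that] by (auto simp: field_simps)
  \<comment> \<open>With \<open>N t \<ge> 0\<close> the later frequencies are at least -m^2/2, and
    with \<open>N t < 0\<close> the earlier ones are at most m^2/2. Doubling this gives the m^2, and
    \<open>quot\<close> adds the 2m, so \<open>c\<close> bounds the logarithmic derivative of
    \<open>H\<close> from the required side in both cases.\<close>
  define c where "c = 2 * m + m\<^sup>2"
  have c: "0 \<le> c" using m by (simp add: c_def)
  have goal: "H t \<le> exp c * (H 0 + H 1)" if "H t \<le> exp c * H x" "x = 0 \<or> x = 1" for x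
    using that H0[of 0] H0[of 1] by (smt (verit) atLeastAtMost_iff exp_ge_zero mult_left_mono)
  have t01: "0 \<le> t" "t \<le> 1" using t by auto
  show ?thesis
  proof (cases "0 \<le> N t")
    case True
    have "(\<lambda>x. ln (H x) + c * x) t \<le> (\<lambda>x. ln (H x) + c * x) 1"
    proof (rule mono_on_Icc_if_deriv_nonneg[OF _ _ t01(2)])
      fix s assume s: "s \<in> {t..1}"
      then have s': "s \<in> {0..1}" using t by auto
      show "((\<lambda>x. ln (H x) + c * x) has_real_derivative
          (2 * G s + 2 * f s) / H s + c) (at s within {t..1})"
        using s t01 pos[OF s'] by (auto intro!: derivative_eq_intros dH')
      have "m\<^sup>2 / 2 * s \<le> m\<^sup>2 / 2 * 1" using s by (intro mult_left_mono) auto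
      moreover have "0 \<le> m\<^sup>2 / 2 * t" using t01 by simp
      moreover have "N t + m\<^sup>2 / 2 * t \<le> N s + m\<^sup>2 / 2 * s"
        using N_mono[of t s] s t01 by simp
      ultimately show "0 \<le> (2 * G s + 2 * f s) / H s + c"
        using True quot(1)[OF s'] unfolding c_def by linarith
    qed
    moreover have "c * (1 - t) \<le> c * 1" using c t01 by (intro mult_left_mono) auto
    ultimately have "ln (H t) \<le> c + ln (H 1)" by (simp add: algebra_simps)
    then have "exp (ln (H t)) \<le> exp (c + ln (H 1))" by simp
    then have "H t \<le> exp c * H 1" using Ht pos[of 1] by (simp add: exp_add)
    then show ?thesis using goal unfolding c_def by blast
  next
    case False
    have "(\<lambda>x. c * x - ln (H x)) 0 \<le> (\<lambda>x. c * x - ln (H x)) t"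
    proof (rule mono_on_Icc_if_deriv_nonneg[OF _ _ t01(1)])
      fix s assume s: "s \<in> {0..t}"
      then have s': "s \<in> {0..1}" using t by auto
      show "((\<lambda>x. c * x - ln (H x)) has_real_derivative
          c - (2 * G s + 2 * f s) / H s) (at s within {0..t})"
        using s t01 pos[OF s'] by (auto intro!: derivative_eq_intros dH')
      have "m\<^sup>2 / 2 * t \<le> m\<^sup>2 / 2 * 1" using t01 by (intro mult_left_mono) auto
      moreover have "0 \<le> m\<^sup>2 / 2 * s" using s by simp
      moreover have "N s + m\<^sup>2 / 2 * s \<le> N t + m\<^sup>2 / 2 * t"
        using N_mono[of s t] s t01 by simp
      ultimately show "0 \<le> c - (2 * G s + 2 * f s) / H s"
        using False quot(2)[OF s'] unfolding c_def by linarith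
    qed
    moreover have "c * t \<le> c * 1" using c t01 by (intro mult_left_mono) auto
    ultimately have "ln (H t) \<le> c + ln (H 0)" by (simp add: algebra_simps)
    then have "exp (ln (H t)) \<le> exp (c + ln (H 0))" by simp
    then have "H t \<le> exp c * H 0" using Ht pos[of 0] by (simp add: exp_add)
    then show ?thesis using goal unfolding c_def by blast
  qed
qed

section \<open>Families with uniformly small square tails\<close>

text \<open>One exceptional set \<open>A\<close> serves all times at once; this uniformity is what
  later permits termwise differentiation. Tails are tested on finite sets only, so the definition
  presupposes no convergence.\<close>

definition unif_sq_summable :: "'t set \<Rightarrow> ('a \<Rightarrow> 't \<Rightarrow> 'b::real_inner) \<Rightarrow> bool" where
  "unif_sq_summable T a \<longleftrightarrow> (\<forall>e>0. \<exists>A. finite A \<and>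
     (\<forall>t\<in>T. \<forall>B. finite B \<longrightarrow> B \<inter> A = {} \<longrightarrow> (\<Sum>j\<in>B. (norm (a j t))\<^sup>2) \<le> e))"

text \<open>For complex values this is the real part of the Hermitian product, the form that appears
  when a squared norm is differentiated. An infinite sum that does not converge has the value 0, so
  additivity needs summability, whereas scaling and shifting hold unconditionally.\<close>

definition l2_inner :: "('a \<Rightarrow> 't \<Rightarrow> 'b::real_inner) \<Rightarrow> ('a \<Rightarrow> 't \<Rightarrow> 'b) \<Rightarrow> 't \<Rightarrow> real" where
  "l2_inner a b t = (\<Sum>\<^sub>\<infinity>j. a j t \<bullet> b j t)"

lemma unif_sq_summableE:
  assumes "unif_sq_summable T a" "e > 0"
  obtains A where "finite A"
    "\<And>t B. t \<in> T \<Longrightarrow> finite B \<Longrightarrow> B \<inter> A = {} \<Longrightarrow> (\<Sum>j\<in>B. (norm (a j t))\<^sup>2) \<le> e"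
proof -
  have "\<exists>A. finite A \<and>
     (\<forall>t\<in>T. \<forall>B. finite B \<longrightarrow> B \<inter> A = {} \<longrightarrow> (\<Sum>j\<in>B. (norm (a j t))\<^sup>2) \<le> e)"
    using assms unfolding unif_sq_summable_def by simp
  then show ?thesis using that by auto
qed

lemma unif_sq_summable_imp_summable:
  assumes "unif_sq_summable T a" "t \<in> T"
  shows "(\<lambda>j. (norm (a j t))\<^sup>2) summable_on UNIV"
proof -
  obtain A where A: "finite A"
    "\<And>t B. t \<in> T \<Longrightarrow> finite B \<Longrightarrow> B \<inter> A = {} \<Longrightarrow> (\<Sum>j\<in>B. (norm (a j t))\<^sup>2) \<le> 1"
    using unif_sq_summableE[OF assms(1), of 1] by auto
  have "(\<Sum>j\<in>F. (norm (a j t))\<^sup>2) \<le> (\<Sum>j\<in>A. (norm (a j t))\<^sup>2) + 1" if "finite F" for F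
  proof -
    have "(\<Sum>j\<in>F. (norm (a j t))\<^sup>2) = (\<Sum>j\<in>F \<inter> A. (norm (a j t))\<^sup>2) + (\<Sum>j\<in>F - A. (norm (a j t))\<^sup>2)"
      using that by (rule sum.Int_Diff)
    moreover have "(\<Sum>j\<in>F \<inter> A. (norm (a j t))\<^sup>2) \<le> (\<Sum>j\<in>A. (norm (a j t))\<^sup>2)"
      using A(1) by (intro sum_mono2) auto
    moreover have "(\<Sum>j\<in>F - A. (norm (a j t))\<^sup>2) \<le> 1"
      using A(2)[OF assms(2), of "F - A"] that by auto
    ultimately show ?thesis by simp
  qed
  then show ?thesis
    by (intro nonneg_bdd_above_summable_on) (auto simp: bdd_above_def)
qed

text \<open>Two dominating families allow sums, differences and bounded multiples to be treated
  alike: the union of their exceptional sets works.\<close>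

lemma unif_sq_summable_dominated:
  assumes a: "unif_sq_summable T a" and b: "unif_sq_summable T b" and c: "c \<ge> 0"
    and le: "\<And>j t. t \<in> T \<Longrightarrow> (norm (d j t))\<^sup>2 \<le> c * ((norm (a j t))\<^sup>2 + (norm (b j t))\<^sup>2)"
  shows "unif_sq_summable T d"
  unfolding unif_sq_summable_def
proof (intro allI impI)
  fix e :: real assume "e > 0"
  \<comment> \<open>The denominator has c + 1 in place of c so that c = 0 is allowed.\<close>
  define e' where "e' = e / (2 * (c + 1))"
  have e': "e' > 0" "2 * (c * e') \<le> e"
    using \<open>e > 0\<close> c by (auto simp: e'_def field_simps)
  obtain A where A: "finite A"
    "\<And>t B. t \<in> T \<Longrightarrow> finite B \<Longrightarrow> B \<inter> A = {} \<Longrightarrow> (\<Sum>j\<in>B. (norm (a j t))\<^sup>2) \<le> e'"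
    using unif_sq_summableE[OF a e'(1)] by blast
  obtain A' where A': "finite A'"
    "\<And>t B. t \<in> T \<Longrightarrow> finite B \<Longrightarrow> B \<inter> A' = {} \<Longrightarrow> (\<Sum>j\<in>B. (norm (b j t))\<^sup>2) \<le> e'"
    using unif_sq_summableE[OF b e'(1)] by blast
  show "\<exists>A. finite A \<and>
     (\<forall>t\<in>T. \<forall>B. finite B \<longrightarrow> B \<inter> A = {} \<longrightarrow> (\<Sum>j\<in>B. (norm (d j t))\<^sup>2) \<le> e)"
  proof (intro exI[of _ "A \<union> A'"] conjI ballI allI impI)
    show "finite (A \<union> A')" using A A' by simp
    fix t B assume t: "t \<in> T" and B: "finite B" "B \<inter> (A \<union> A') = {}"
    have "(\<Sum>j\<in>B. (norm (d j t))\<^sup>2) \<le> (\<Sum>j\<in>B. c * ((norm (a j t))\<^sup>2 + (norm (b j t))\<^sup>2))"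
      using le[OF t] by (rule sum_mono)
    also have "\<dots> = c * ((\<Sum>j\<in>B. (norm (a j t))\<^sup>2) + (\<Sum>j\<in>B. (norm (b j t))\<^sup>2))"
      by (simp add: sum.distrib flip: sum_distrib_left)
    also have "\<dots> \<le> c * (e' + e')"
      using A(2)[OF t B(1)] A'(2)[OF t B(1)] B(2) c by (intro mult_left_mono add_mono) auto
    finally show "(\<Sum>j\<in>B. (norm (d j t))\<^sup>2) \<le> e" using e'(2) by simp
  qed
qed

lemma unif_sq_summable_bounded_multiple:
  assumes a: "unif_sq_summable T a" and c: "c \<ge> 0"
    and le: "\<And>j t. t \<in> T \<Longrightarrow> norm (d j t) \<le> c * norm (a j t)"
  shows "unif_sq_summable T d"
proof (rule unif_sq_summable_dominated[OF a a, of "c\<^sup>2"])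
  fix j t assume "t \<in> T"
  then have "(norm (d j t))\<^sup>2 \<le> (c * norm (a j t))\<^sup>2"
    using le by (intro power_mono) auto
  also have "\<dots> \<le> c\<^sup>2 * ((norm (a j t))\<^sup>2 + (norm (a j t))\<^sup>2)"
    by (auto simp: power_mult_distrib intro!: mult_left_mono)
  finally show "(norm (d j t))\<^sup>2 \<le> c\<^sup>2 * ((norm (a j t))\<^sup>2 + (norm (a j t))\<^sup>2)" .
qed simp

lemma unif_sq_summable_add:
  assumes "unif_sq_summable T a" and "unif_sq_summable T b"
  shows "unif_sq_summable T (\<lambda>j t. a j t + b j t)"
proof (rule unif_sq_summable_dominated[OF assms, of 2])
  fix j t
  have "(norm (a j t + b j t))\<^sup>2 \<le> (norm (a j t) + norm (b j t))\<^sup>2"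
    by (intro power_mono norm_triangle_ineq) auto
  also have "\<dots> \<le> 2 * ((norm (a j t))\<^sup>2 + (norm (b j t))\<^sup>2)"
    using sum_squares_bound[of "norm (a j t)" "norm (b j t)"] by (simp add: power2_sum)
  finally show "(norm (a j t + b j t))\<^sup>2 \<le> 2 * ((norm (a j t))\<^sup>2 + (norm (b j t))\<^sup>2)" .
qed simp

lemma unif_sq_summable_zero: "unif_sq_summable T (\<lambda>j t. 0)"
  unfolding unif_sq_summable_def by (auto intro!: exI[of _ "{}"])

lemma unif_sq_summable_uminus:
  "unif_sq_summable T a \<Longrightarrow> unif_sq_summable T (\<lambda>j t. - a j t)"
  by (erule unif_sq_summable_bounded_multiple[of _ _ 1]) auto

lemma unif_sq_summable_diff:
  assumes "unif_sq_summable T a" and "unif_sq_summable T b"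
  shows "unif_sq_summable T (\<lambda>j t. a j t - b j t)"
  using unif_sq_summable_add[OF assms(1) unif_sq_summable_uminus[OF assms(2)]] by simp

lemma unif_sq_summable_scaleR:
  "unif_sq_summable T a \<Longrightarrow> unif_sq_summable T (\<lambda>j t. r *\<^sub>R a j t)"
  by (erule unif_sq_summable_bounded_multiple[of _ _ "\<bar>r\<bar>"]) auto

lemma unif_sq_summable_mult:
  fixes a :: "'a \<Rightarrow> 't \<Rightarrow> complex"
  shows "unif_sq_summable T a \<Longrightarrow> unif_sq_summable T (\<lambda>j t. c * a j t)"
  by (erule unif_sq_summable_bounded_multiple[of _ _ "norm c"]) (auto simp: norm_mult)

lemma unif_sq_summable_sum:
  assumes "\<And>k. k \<in> K \<Longrightarrow> unif_sq_summable T (a k)"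
  shows "unif_sq_summable T (\<lambda>j t. \<Sum>k\<in>K. a k j t)"
  using assms
  by (induction K rule: infinite_finite_induct)
     (auto intro: unif_sq_summable_zero unif_sq_summable_add)

lemma unif_sq_summable_shift:
  fixes e :: "'a::ab_group_add"
  assumes a: "unif_sq_summable T a"
  shows "unif_sq_summable T (\<lambda>j. a (j + e))"
  unfolding unif_sq_summable_def
proof (intro allI impI)
  fix r :: real assume "r > 0"
  obtain A where A: "finite A"
    "\<And>t B. t \<in> T \<Longrightarrow> finite B \<Longrightarrow> B \<inter> A = {} \<Longrightarrow> (\<Sum>j\<in>B. (norm (a j t))\<^sup>2) \<le> r"
    using unif_sq_summableE[OF a \<open>r > 0\<close>] by blast
  show "\<exists>A. finite A \<and>
     (\<forall>t\<in>T. \<forall>B. finite B \<longrightarrow> B \<inter> A = {} \<longrightarrow> (\<Sum>j\<in>B. (norm (a (j + e) t))\<^sup>2) \<le> r)"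
  proof (intro exI[of _ "(\<lambda>j. j - e) ` A"] conjI ballI allI impI)
    show "finite ((\<lambda>j. j - e) ` A)" using A by simp
    fix t B assume t: "t \<in> T" and B: "finite B" "B \<inter> (\<lambda>j. j - e) ` A = {}"
    have "(\<Sum>j\<in>B. (norm (a (j + e) t))\<^sup>2) = (\<Sum>j\<in>(\<lambda>j. j + e) ` B. (norm (a j t))\<^sup>2)"
      by (simp add: sum.reindex)
    also have "\<dots> \<le> r"
    proof (rule A(2)[OF t])
      have "j \<in> (\<lambda>j. j - e) ` A" if "j + e \<in> A" for j
        using that by (intro image_eqI[of _ _ "j + e"]) auto
      then show "(\<lambda>j. j + e) ` B \<inter> A = {}" using B by auto
    qed (use B in simp)
    finally show "(\<Sum>j\<in>B. (norm (a (j + e) t))\<^sup>2) \<le> r" .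
  qed
qed

lemma unif_sq_summable_shift_diff:
  fixes e :: "'a::ab_group_add"
  shows "unif_sq_summable T a \<Longrightarrow> unif_sq_summable T (\<lambda>j. a (j - e))"
  using unif_sq_summable_shift[of T a "- e"] by simp

lemmas unif_sq_summable_intros =
  unif_sq_summable_add unif_sq_summable_diff unif_sq_summable_scaleR unif_sq_summable_mult
  unif_sq_summable_sum unif_sq_summable_shift unif_sq_summable_shift_diff

section \<open>The real inner product\<close>

lemma abs_inner_le_sum_squares: "\<bar>x \<bullet> y\<bar> \<le> (norm x)\<^sup>2 + (norm y)\<^sup>2"
proof -
  have "\<bar>x \<bullet> y\<bar> \<le> norm x * norm y" by (rule Cauchy_Schwarz_ineq2)
  also have "\<dots> \<le> (norm x)\<^sup>2 + (norm y)\<^sup>2"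
    using sum_squares_bound[of "norm x" "norm y"] mult_nonneg_nonneg[OF norm_ge_zero norm_ge_zero, of x y]
    by linarith
  finally show ?thesis .
qed

lemma l2_inner_summable:
  assumes "unif_sq_summable T a" "unif_sq_summable T b" "t \<in> T"
  shows "(\<lambda>j. a j t \<bullet> b j t) summable_on UNIV"
proof -
  have "(\<lambda>j. (norm (a j t))\<^sup>2 + (norm (b j t))\<^sup>2) summable_on UNIV"
    using assms by (intro summable_on_add unif_sq_summable_imp_summable)
  then have "(\<lambda>j. \<bar>a j t \<bullet> b j t\<bar>) summable_on UNIV"
    by (rule summable_on_comparison_test) (auto simp: abs_inner_le_sum_squares)
  then show ?thesis
    using abs_summable_summable[of "\<lambda>j. a j t \<bullet> b j t" UNIV] by simp
qed

lemma l2_inner_commute: "l2_inner a b t = l2_inner b a t"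
  unfolding l2_inner_def by (simp add: inner_commute)

context
  fixes T :: "'t set" and t :: 't
  assumes t: "t \<in> T"
begin

lemma l2_inner_add_right:
  assumes "unif_sq_summable T a" "unif_sq_summable T b" "unif_sq_summable T c"
  shows "l2_inner a (\<lambda>j t. b j t + c j t) t = l2_inner a b t + l2_inner a c t"
  using assms t unfolding l2_inner_def inner_add_right
  by (intro infsum_add l2_inner_summable)

lemma l2_inner_diff_right:
  assumes "unif_sq_summable T a" "unif_sq_summable T b" "unif_sq_summable T c"
  shows "l2_inner a (\<lambda>j t. b j t - c j t) t = l2_inner a b t - l2_inner a c t"
  using l2_inner_add_right[OF assms(1,2) unif_sq_summable_uminus[OF assms(3)]]
  by (simp add: l2_inner_def infsum_uminus)

lemma l2_inner_sum_right:
  assumes "unif_sq_summable T a" "\<And>k. k \<in> K \<Longrightarrow> unif_sq_summable T (b k)"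
  shows "l2_inner a (\<lambda>j t. \<Sum>k\<in>K. b k j t) t = (\<Sum>k\<in>K. l2_inner a (b k) t)"
  using assms(2)
proof (induction K rule: infinite_finite_induct)
  case (insert k K)
  then show ?case
    using assms(1) by (simp add: l2_inner_add_right unif_sq_summable_sum)
qed (auto simp: l2_inner_def)

lemma l2_inner_add_left:
  assumes "unif_sq_summable T a" "unif_sq_summable T b" "unif_sq_summable T c"
  shows "l2_inner (\<lambda>j t. b j t + c j t) a t = l2_inner b a t + l2_inner c a t"
  using l2_inner_add_right[OF assms] by (simp add: l2_inner_commute)

lemma l2_inner_diff_left:
  assumes "unif_sq_summable T a" "unif_sq_summable T b" "unif_sq_summable T c"
  shows "l2_inner (\<lambda>j t. b j t - c j t) a t = l2_inner b a t - l2_inner c a t"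
  using l2_inner_diff_right[OF assms] by (simp add: l2_inner_commute)

lemma l2_inner_sum_left:
  assumes "unif_sq_summable T a" "\<And>k. k \<in> K \<Longrightarrow> unif_sq_summable T (b k)"
  shows "l2_inner (\<lambda>j t. \<Sum>k\<in>K. b k j t) a t = (\<Sum>k\<in>K. l2_inner (b k) a t)"
  using l2_inner_sum_right[OF assms] by (simp add: l2_inner_commute)

end

lemma l2_inner_scaleR_right: "l2_inner a (\<lambda>j t. r *\<^sub>R b j t) t = r * l2_inner a b t"
  unfolding l2_inner_def by (simp add: infsum_cmult_right')

lemma l2_inner_scaleR_left: "l2_inner (\<lambda>j t. r *\<^sub>R b j t) a t = r * l2_inner b a t"
  unfolding l2_inner_def by (simp add: infsum_cmult_right')

lemma l2_inner_shift:
  fixes e :: "'a::ab_group_add"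
  shows "l2_inner a (\<lambda>j. b (j + e)) t = l2_inner (\<lambda>j. a (j - e)) b t"
proof -
  have "bij_betw (\<lambda>j. j + e) UNIV UNIV"
    by (rule bij_betwI[of _ _ _ "\<lambda>j. j - e"]) auto
  from infsum_reindex_bij_betw[OF this, of "\<lambda>j. a (j - e) t \<bullet> b j t"]
  show ?thesis unfolding l2_inner_def by simp
qed

lemma l2_inner_shift_diff:
  fixes e :: "'a::ab_group_add"
  shows "l2_inner a (\<lambda>j. b (j - e)) t = l2_inner (\<lambda>j. a (j + e)) b t"
  using l2_inner_shift[of a b "- e"] by simp

text \<open>Multiplication by i is skew for the real inner product. It thus turns a skew combination
  of shifts into a symmetric operator and a symmetric one into a skew operator.\<close>

lemma l2_inner_mult_ii:
  "l2_inner a (\<lambda>j t. \<i> * b j t) t = - l2_inner (\<lambda>j t. \<i> * a j t) b t"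
  unfolding l2_inner_def by (simp add: inner_complex_def flip: infsum_uminus)

lemma l2_inner_self_nonneg: "0 \<le> l2_inner a a t"
  unfolding l2_inner_def by (intro infsum_nonneg) simp

lemma l2_inner_self_le:
  assumes "unif_sq_summable T a" "unif_sq_summable T b" "t \<in> T"
    and "\<And>j. norm (b j t) \<le> c * norm (a j t)" 
  shows "l2_inner b b t \<le> c\<^sup>2 * l2_inner a a t"
proof -
  have "b j t \<bullet> b j t \<le> c\<^sup>2 * (a j t \<bullet> a j t)" for j
    using power_mono[OF assms(4)[of j], of 2]
    by (simp add: power_mult_distrib power2_norm_eq_inner)
  then have "l2_inner b b t \<le> (\<Sum>\<^sub>\<infinity>j. c\<^sup>2 * (a j t \<bullet> a j t))"
    unfolding l2_inner_def using assms
    by (intro infsum_mono summable_on_cmult_right l2_inner_summable) auto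
  then show ?thesis
    unfolding l2_inner_def by (simp add: infsum_cmult_right')
qed

lemma l2_inner_abs_le:
  assumes "unif_sq_summable T a" "unif_sq_summable T b" "t \<in> T"
    and "\<And>j. norm (b j t) \<le> c * norm (a j t)" 
  shows "\<bar>l2_inner a b t\<bar> \<le> c * l2_inner a a t"
proof -
  have le: "\<bar>a j t \<bullet> b j t\<bar> \<le> c * (a j t \<bullet> a j t)" for j
  proof -
    have "\<bar>a j t \<bullet> b j t\<bar> \<le> norm (a j t) * norm (b j t)" by (rule Cauchy_Schwarz_ineq2)
    also have "\<dots> \<le> norm (a j t) * (c * norm (a j t))"
      by (intro mult_left_mono assms(4)) simp
    finally show ?thesis by (simp add: mult_ac power2_norm_eq_inner flip: power2_eq_square)
  qed
  have sb: "(\<lambda>j. a j t \<bullet> b j t) summable_on UNIV"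
    and sa: "(\<lambda>j. c * (a j t \<bullet> a j t)) summable_on UNIV"
    using assms by (auto intro!: summable_on_cmult_right l2_inner_summable)
  have sb': "(\<lambda>j. - (a j t \<bullet> b j t)) summable_on UNIV"
    using sb by (simp add: summable_on_uminus)
  have "l2_inner a b t \<le> (\<Sum>\<^sub>\<infinity>j. c * (a j t \<bullet> a j t))"
    unfolding l2_inner_def using le by (intro infsum_mono sa sb) (use abs_le_D1 in blast)
  moreover have "- l2_inner a b t \<le> (\<Sum>\<^sub>\<infinity>j. c * (a j t \<bullet> a j t))"
    unfolding l2_inner_def infsum_uminus[symmetric]
    by (rule infsum_mono[OF sb' sa]) (rule abs_le_D2[OF le])
  ultimately show ?thesis
    unfolding l2_inner_def by (simp add: infsum_cmult_right')
qed

section \<open>Uniform convergence and termwise differentiation in time\<close>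

text \<open>Outside a finite set the products are dominated by the two square tails, which are small
  for all times simultaneously. Each tail gets e/3, so that the total 2e/3 stays strictly below
  e.\<close>

lemma l2_inner_uniform_limit:
  assumes a: "unif_sq_summable T a" and b: "unif_sq_summable T b"
  shows "uniform_limit T (\<lambda>A t. \<Sum>j\<in>A. a j t \<bullet> b j t) (l2_inner a b) (finite_subsets_at_top UNIV)"
proof (rule uniform_limitI)
  fix e :: real assume "e > 0"
  then have e: "e / 3 > 0" by simp
  obtain A where A: "finite A"
    "\<And>t B. t \<in> T \<Longrightarrow> finite B \<Longrightarrow> B \<inter> A = {} \<Longrightarrow> (\<Sum>j\<in>B. (norm (a j t))\<^sup>2) \<le> e / 3"
    using unif_sq_summableE[OF a e] by blast
  obtain A' where A': "finite A'"
    "\<And>t B. t \<in> T \<Longrightarrow> finite B \<Longrightarrow> B \<inter> A' = {} \<Longrightarrow> (\<Sum>j\<in>B. (norm (b j t))\<^sup>2) \<le> e / 3"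
    using unif_sq_summableE[OF b e] by blast
  have "dist (\<Sum>j\<in>B. a j t \<bullet> b j t) (l2_inner a b t) < e"
    if B: "finite B" "A \<union> A' \<subseteq> B" and t: "t \<in> T" for B t
  proof -
    have s: "(\<lambda>j. a j t \<bullet> b j t) summable_on UNIV"
      by (rule l2_inner_summable[OF a b t])
    have s': "(\<lambda>j. \<bar>a j t \<bullet> b j t\<bar>) summable_on (- B)"
      using s summable_on_iff_abs_summable_on_real[of "\<lambda>j. a j t \<bullet> b j t" UNIV]
      by (auto intro: summable_on_subset_banach)
    have "\<bar>\<Sum>\<^sub>\<infinity>j\<in>-B. a j t \<bullet> b j t\<bar> \<le> (\<Sum>\<^sub>\<infinity>j\<in>-B. \<bar>a j t \<bullet> b j t\<bar>)"
      using norm_infsum_bound[of "\<lambda>j. a j t \<bullet> b j t" "- B"] s' by simp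
    also have "\<dots> \<le> e / 3 + e / 3"
    proof (rule infsum_le_finite_sums[OF s'])
      fix F assume F: "finite F" "F \<subseteq> - B"
      have "(\<Sum>j\<in>F. \<bar>a j t \<bullet> b j t\<bar>) \<le> (\<Sum>j\<in>F. (norm (a j t))\<^sup>2 + (norm (b j t))\<^sup>2)"
        by (intro sum_mono abs_inner_le_sum_squares)
      also have "\<dots> \<le> e / 3 + e / 3"
        unfolding sum.distrib using F B by (intro add_mono A(2)[OF t] A'(2)[OF t]) auto
      finally show "(\<Sum>j\<in>F. \<bar>a j t \<bullet> b j t\<bar>) \<le> e / 3 + e / 3" .
    qed
    also have "\<dots> < e" using \<open>e > 0\<close> by simp
    finally have "\<bar>\<Sum>\<^sub>\<infinity>j\<in>-B. a j t \<bullet> b j t\<bar> < e" .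
    moreover have "(\<Sum>\<^sub>\<infinity>j\<in>-B. a j t \<bullet> b j t) = l2_inner a b t - (\<Sum>j\<in>B. a j t \<bullet> b j t)"
      unfolding l2_inner_def Compl_eq_Diff_UNIV using B by (subst infsum_Diff[OF s]) auto
    ultimately show ?thesis
      by (simp add: dist_real_def abs_minus_commute)
  qed
  then show "\<forall>\<^sub>F A in finite_subsets_at_top UNIV. \<forall>t\<in>T.
      dist (\<Sum>j\<in>A. a j t \<bullet> b j t) (l2_inner a b t) < e"
    unfolding eventually_finite_subsets_at_top using A(1) A'(1)
    by (intro exI[of _ "A \<union> A'"]) auto
qed

text \<open>The finite partial sums converge pointwise and their derivatives converge uniformly, so
  the limit may be differentiated. Neither continuity nor integrability of the derivatives in time
  enters.\<close>

lemma l2_inner_has_real_derivative: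
  fixes a b a' b' :: "'a::countable \<Rightarrow> real \<Rightarrow> 'b::real_inner"
  assumes T: "convex T"
    and da: "\<And>j t. t \<in> T \<Longrightarrow> (a j has_vector_derivative a' j t) (at t within T)"
    and db: "\<And>j t. t \<in> T \<Longrightarrow> (b j has_vector_derivative b' j t) (at t within T)"
    and a: "unif_sq_summable T a" and a': "unif_sq_summable T a'"
    and b: "unif_sq_summable T b" and b': "unif_sq_summable T b'"
    and t: "t \<in> T"
  shows "(l2_inner a b has_real_derivative l2_inner a' b t + l2_inner a b' t) (at t within T)"
proof -
  \<comment> \<open>\<open>has_derivative_sequence\<close> is about sequences, so the filter of
    finite sets is replaced by an exhaustion along an enumeration of the countable index
    type.\<close>
  define A where "A n = {j::'a. to_nat j < n}" for n
  have fin: "finite (A n)" for n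
    unfolding A_def using finite_vimageI[OF finite_lessThan[of n] inj_to_nat[where 'a = 'a]]
    by (simp add: vimage_def)
  have lim: "filterlim A (finite_subsets_at_top UNIV) sequentially"
    unfolding filterlim_finite_subsets_at_top
  proof (intro allI impI, elim conjE)
    fix X :: "'a set" assume "finite X"
    then obtain m where m: "to_nat ` X \<subseteq> {..<m}"
      by (meson finite_imageI finite_nat_set_iff_bounded lessThan_iff subsetI)
    show "\<forall>\<^sub>F n in sequentially. finite (A n) \<and> X \<subseteq> A n \<and> A n \<subseteq> UNIV"
      using eventually_ge_at_top[of m]
    proof eventually_elim
      case (elim n)
      then show ?case using m fin by (force simp: A_def)
    qed
  qed
  define F where "F n s = (\<Sum>j\<in>A n. a j s \<bullet> b j s)" for n s
  define F' where "F' n s = (\<Sum>j\<in>A n. a' j s \<bullet> b j s) + (\<Sum>j\<in>A n. a j s \<bullet> b' j s)" for n s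
  define g where "g s = l2_inner a' b s + l2_inner a b' s" for s
  have FT: "(\<lambda>n. F n s) \<longlonglongrightarrow> l2_inner a b s" if "s \<in> T" for s
    unfolding F_def
    by (rule filterlim_compose[OF tendsto_uniform_limitI[OF l2_inner_uniform_limit[OF a b] that] lim])
  have F'T: "uniform_limit T F' g sequentially"
  proof -
    have "uniform_limit T (\<lambda>A s. (\<Sum>j\<in>A. a' j s \<bullet> b j s) + (\<Sum>j\<in>A. a j s \<bullet> b' j s)) g
        (finite_subsets_at_top UNIV)"
      unfolding g_def by (intro uniform_limit_add l2_inner_uniform_limit a a' b b')
    then have "uniform_limit T (\<lambda>n s. (\<Sum>j\<in>A n. a' j s \<bullet> b j s) + (\<Sum>j\<in>A n. a j s \<bullet> b' j s)) g
        sequentially"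
      by (rule filterlim_compose[OF _ lim])
    then show ?thesis
      by (simp add: F'_def[abs_def])
  qed
  have "\<exists>G. \<forall>s\<in>T. (\<lambda>n. F n s) \<longlonglongrightarrow> G s \<and> (G has_derivative (*) (g s)) (at s within T)"
  proof (rule has_derivative_sequence[where f = F and f' = "\<lambda>n s. (*) (F' n s)", OF T _ _ t FT[OF t]])
    fix n s assume s: "s \<in> T"
    have "((\<lambda>x. a j x \<bullet> b j x) has_derivative
        (\<lambda>h. (a' j s \<bullet> b j s + a j s \<bullet> b' j s) * h)) (at s within T)" for j
      using has_derivative_inner[OF da[OF s, of j, unfolded has_vector_derivative_def]
          db[OF s, of j, unfolded has_vector_derivative_def]]
      by (rule has_derivative_eq_rhs) (auto simp: algebra_simps)
    then have "(F n has_derivative (\<lambda>h. \<Sum>j\<in>A n. (a' j s \<bullet> b j s + a j s \<bullet> b' j s) * h)) (at s within T)"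
      unfolding F_def by (intro has_derivative_sum)
    then show "(F n has_derivative (*) (F' n s)) (at s within T)"
      by (rule has_derivative_eq_rhs)
         (auto simp: F'_def sum.distrib sum_distrib_right distrib_right)
  next
    fix e :: real assume "e > 0"
    from uniform_limitD[OF F'T this]
    show "\<forall>\<^sub>F n in sequentially. \<forall>x\<in>T. \<forall>h. norm (F' n x * h - g x * h) \<le> e * norm h"
    proof eventually_elim
      case (elim n)
      then show ?case
        by (auto simp: dist_real_def abs_mult less_imp_le mult_right_mono simp flip: left_diff_distrib)
    qed
  qed
  then obtain G where G: "\<And>s. s \<in> T \<Longrightarrow> (\<lambda>n. F n s) \<longlonglongrightarrow> G s"
    "\<And>s. s \<in> T \<Longrightarrow> (G has_derivative (*) (g s)) (at s within T)" by blast
  \<comment> \<open>The sequence theorem only provides some differentiable limit \<open>G\<close>;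
    uniqueness of limits identifies it with the inner product.\<close>
  have "l2_inner a b s = G s" if "s \<in> T" for s
    using FT[OF that] G(1)[OF that] by (rule LIMSEQ_unique)
  then show ?thesis
    unfolding has_field_derivative_def g_def[symmetric]
    using has_derivative_transform[OF t _ G(2)[OF t]] by blast
qed

section \<open>A Gronwall estimate for weighted sums\<close>

text \<open>The differential equation is separated from the norm bound in
  \<open>schroedinger_solution\<close>, which enters the estimates below as a real bound on finite
  sums.\<close>

definition lattice_equation :: "(int ^ 'd \<Rightarrow> real \<Rightarrow> complex) \<Rightarrow> (int ^ 'd \<Rightarrow> real \<Rightarrow> complex) \<Rightarrow> bool" where
  "lattice_equation V u \<longleftrightarrow> (\<forall>j. \<forall>t\<in>{0..1}. (u j has_vector_derivative
     \<i> * (lattice_laplacian (\<lambda>l. u l t) j + V j t * u j t)) (at t within {0..1}))"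

text \<open>The diagonal term of the Laplacian drops out because \<open>x \<bullet> \<i>x = 0\<close>.\<close>

lemma inner_schroedinger_le:
  fixes w :: "int ^ 'd::finite \<Rightarrow> complex"
  assumes "cmod z \<le> m"
  shows "2 * (w j \<bullet> (\<i> * (lattice_laplacian w j + z * w j))) \<le>
    (\<Sum>k\<in>UNIV. (cmod (w (j + axis k 1)))\<^sup>2 + (cmod (w (j - axis k 1)))\<^sup>2 + 2 * (cmod (w j))\<^sup>2)
      + 2 * m * (cmod (w j))\<^sup>2"
proof -
  have amgm: "2 * (w j \<bullet> (\<i> * y)) \<le> (cmod y)\<^sup>2 + (cmod (w j))\<^sup>2" for y
    using Cauchy_Schwarz_ineq2[of "w j" "\<i> * y"] sum_squares_bound[of "cmod (w j)" "cmod y"]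
    by (simp add: norm_mult abs_le_iff)
  have "2 * (w j \<bullet> (\<i> * (w (j + axis k 1) - 2 * w j + w (j - axis k 1)))) \<le>
      (cmod (w (j + axis k 1)))\<^sup>2 + (cmod (w (j - axis k 1)))\<^sup>2 + 2 * (cmod (w j))\<^sup>2" for k
  proof -
    have "w j \<bullet> (\<i> * (w (j + axis k 1) - 2 * w j + w (j - axis k 1)))
      = w j \<bullet> (\<i> * w (j + axis k 1)) + w j \<bullet> (\<i> * w (j - axis k 1))"
      by (simp add: inner_complex_def algebra_simps)
    then show ?thesis
      using amgm[of "w (j + axis k 1)"] amgm[of "w (j - axis k 1)"] by simp
  qed
  then have "2 * (w j \<bullet> (\<i> * lattice_laplacian w j)) \<le>
      (\<Sum>k\<in>UNIV. (cmod (w (j + axis k 1)))\<^sup>2 + (cmod (w (j - axis k 1)))\<^sup>2 + 2 * (cmod (w j))\<^sup>2)"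
    unfolding lattice_laplacian_def sum_distrib_left inner_sum_right
    by (intro sum_mono) simp
  moreover have "w j \<bullet> (\<i> * (z * w j)) \<le> m * (cmod (w j))\<^sup>2"
  proof -
    have "w j \<bullet> (\<i> * (z * w j)) \<le> cmod (w j) * (cmod z * cmod (w j))"
      using norm_cauchy_schwarz[of "w j" "\<i> * (z * w j)"] by (simp add: norm_mult)
    also have "\<dots> \<le> cmod (w j) * (m * cmod (w j))"
      using assms by (intro mult_left_mono mult_right_mono) auto
    finally show ?thesis by (simp add: power2_eq_square mult_ac)
  qed
  ultimately show ?thesis
    by (simp add: distrib_left inner_add_right)
qed

text \<open>The least \<open>X\<close> such that \<open>X exp (4Kt)\<close> bounds all finite partial sums satisfies \<open>X \<le> s + X / 2\<close>. The
  weight and the \<open>\<ell>\<^sup>2\<close> norm of \<open>u\<close> have to be bounded for \<open>X\<close> to be finite.\<close>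

lemma weighted_bound_bounded_weight:
  fixes u V :: "int ^ 'd::finite \<Rightarrow> real \<Rightarrow> complex" and w :: "int ^ 'd \<Rightarrow> real" and L m s :: real
  assumes eq: "lattice_equation V u"
    and V: "\<And>j t. t \<in> {0..1} \<Longrightarrow> cmod (V j t) \<le> m"
    and B: "\<And>t A. t \<in> {0..1} \<Longrightarrow> finite A \<Longrightarrow> (\<Sum>j\<in>A. (cmod (u j t))\<^sup>2) \<le> B"
    and w: "\<And>j. 0 \<le> w j" "\<And>j. w j \<le> W"
    and L: "\<And>j k. w j \<le> L * w (j + axis k 1)" "\<And>j k. w j \<le> L * w (j - axis k 1)" "0 \<le> L"
    and m: "0 \<le> m"
    and init: "\<And>A. finite A \<Longrightarrow> (\<Sum>j\<in>A. w j * (cmod (u j 0))\<^sup>2) \<le> s"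
    and t: "t \<in> {0..1}" and A: "finite A"
  shows "(\<Sum>j\<in>A. w j * (cmod (u j t))\<^sup>2) \<le> 2 * exp (4 * (CARD('d) * (L + 1) + m)) * s"
proof -
  define K where "K = CARD('d) * (L + 1) + m"
  have K: "0 \<le> K" using L m unfolding K_def by simp
  define \<Phi> where "\<Phi> A t = (\<Sum>j\<in>A. w j * (cmod (u j t))\<^sup>2)" for A t
  define S where "S = {exp (- 4 * K * t) * \<Phi> A t | A t. finite A \<and> t \<in> {0..(1::real)}}"
  have SI: "exp (- 4 * K * t) * \<Phi> A t \<in> S" if "finite A" "t \<in> {0..1}" for A and t :: real
    using that unfolding S_def by blast
  have \<Phi>0: "0 \<le> \<Phi> A t" for A t
    unfolding \<Phi>_def using w by (intro sum_nonneg) auto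
  \<comment> \<open>The exponential factor is at most 1, the weight at most \<open>W\<close> and the
    squared norm at most \<open>B\<close>.\<close>
  have bdd: "bdd_above S"
    unfolding bdd_above_def
  proof (intro exI ballI)
    fix x assume "x \<in> S"
    then obtain A and t :: real where x: "x = exp (- 4 * K * t) * \<Phi> A t" "finite A" "t \<in> {0..1}"
      unfolding S_def by blast
    have "x \<le> 1 * \<Phi> A t"
      unfolding x using x(3) K \<Phi>0 by (intro mult_right_mono) auto
    also have "\<dots> \<le> (\<Sum>j\<in>A. W * (cmod (u j t))\<^sup>2)"
      unfolding \<Phi>_def mult_1 using w by (intro sum_mono mult_right_mono) auto
    also have "\<dots> \<le> W * B"
      using B[OF x(3,2)] order_trans[OF w] unfolding sum_distrib_left[symmetric]
      by (intro mult_left_mono) auto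
    finally show "x \<le> W * B" .
  qed
  define X where "X = Sup S"
  have \<Phi>_le: "\<Phi> A t \<le> X * exp (4 * K * t)" if "finite A" "t \<in> {0..1}" for A and t :: real
    using cSup_upper[OF SI[OF that] bdd]
    by (simp add: X_def exp_minus field_simps)
  have deriv_le: "(\<Sum>j\<in>A. w j * (2 * (u j t \<bullet> (\<i> * (lattice_laplacian (\<lambda>l. u l t) j + V j t * u j t)))))
      \<le> 2 * K * (X * exp (4 * K * t))" if A: "finite A" and t: "t \<in> {0..1}" for A and t :: real
  proof -
    define Y where "Y = X * exp (4 * K * t)"
    \<comment> \<open>Neighbouring sites may leave \<open>A\<close>. Moving the weight to the
      neighbour costs a factor \<open>L\<close>, and the sum over the translated finite set is again
      controlled by \<open>X\<close>, since \<open>X\<close> bounds all finite sums.\<close>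
    have shift: "(\<Sum>j\<in>A. w j * (cmod (u (f j) t))\<^sup>2) \<le> L * Y"
      if "inj f" "\<And>j. w j \<le> L * w (f j)" for f
    proof -
      have "(\<Sum>j\<in>A. w j * (cmod (u (f j) t))\<^sup>2) \<le> (\<Sum>j\<in>A. L * (w (f j) * (cmod (u (f j) t))\<^sup>2))"
        unfolding mult.assoc[symmetric] by (intro sum_mono mult_right_mono that) auto
      also have "\<dots> = L * \<Phi> (f ` A) t"
        unfolding \<Phi>_def using that(1) by (simp add: sum.reindex inj_on_def inj_def sum_distrib_left)
      also have "\<dots> \<le> L * Y"
        unfolding Y_def using A t L by (intro mult_left_mono \<Phi>_le) auto
      finally show ?thesis .
    qed
    have "(\<Sum>j\<in>A. w j * (2 * (u j t \<bullet> (\<i> * (lattice_laplacian (\<lambda>l. u l t) j + V j t * u j t)))))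
      \<le> (\<Sum>j\<in>A. w j * ((\<Sum>k\<in>UNIV. (cmod (u (j + axis k 1) t))\<^sup>2 + (cmod (u (j - axis k 1) t))\<^sup>2
            + 2 * (cmod (u j t))\<^sup>2) + 2 * m * (cmod (u j t))\<^sup>2))"
      by (intro sum_mono mult_left_mono inner_schroedinger_le[of _ m "\<lambda>l. u l t"] V w t)
    also have "\<dots> = (\<Sum>j\<in>A. \<Sum>k\<in>UNIV. w j * (cmod (u (j + axis k 1) t))\<^sup>2
        + w j * (cmod (u (j - axis k 1) t))\<^sup>2 + 2 * (w j * (cmod (u j t))\<^sup>2)) + 2 * m * \<Phi> A t"
      by (simp add: \<Phi>_def sum_distrib_left distrib_left sum.distrib mult_ac)
    also have "(\<Sum>j\<in>A. \<Sum>k\<in>UNIV. w j * (cmod (u (j + axis k 1) t))\<^sup>2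
        + w j * (cmod (u (j - axis k 1) t))\<^sup>2 + 2 * (w j * (cmod (u j t))\<^sup>2))
      = (\<Sum>k\<in>UNIV. (\<Sum>j\<in>A. w j * (cmod (u (j + axis k 1) t))\<^sup>2)
        + (\<Sum>j\<in>A. w j * (cmod (u (j - axis k 1) t))\<^sup>2) + 2 * \<Phi> A t)"
      by (subst sum.swap) (simp add: \<Phi>_def sum.distrib flip: sum_distrib_left)
    also have "\<dots> \<le> (\<Sum>k\<in>(UNIV::'d set). L * Y + L * Y + 2 * Y)"
      using \<Phi>_le[OF A t]
      by (intro sum_mono add_mono shift L) (auto simp: inj_def Y_def)
    also have "2 * m * \<Phi> A t \<le> 2 * m * Y"
      unfolding Y_def using m by (intro mult_left_mono \<Phi>_le A t) auto
    \<comment> \<open>Each of the CARD('d) directions costs 2L + 2 and the potential costs 2m, which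
      explains the value of \<open>K\<close>.\<close>
    also have "(\<Sum>k\<in>(UNIV::'d set). L * Y + L * Y + 2 * Y) + 2 * m * Y = 2 * K * Y"
      by (simp add: K_def algebra_simps)
    finally show ?thesis by (simp add: Y_def)
  qed
  have improve: "exp (- 4 * K * t) * \<Phi> A t \<le> s + X / 2" if A: "finite A" and t: "t \<in> {0..1}" for A and t :: real
  proof -
    define D where "D r = (\<Sum>j\<in>A. w j * (2 * (u j r \<bullet> (\<i> * (lattice_laplacian (\<lambda>l. u l r) j + V j r * u j r)))))" for r
    have "0 \<le> t" using t by simp
    \<comment> \<open>The derivative of \<open>X / 2 * exp (4 * K * r)\<close> is exactly the bound
      in \<open>deriv_le\<close>. The exponent 4K, twice the rate 2K found there, is what gains the
      factor 1/2 in front of \<open>X\<close>.\<close>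
    have "(\<lambda>r. X / 2 * exp (4 * K * r) - \<Phi> A r) 0 \<le> (\<lambda>r. X / 2 * exp (4 * K * r) - \<Phi> A r) t"
    proof (rule mono_on_Icc_if_deriv_nonneg[OF _ _ \<open>0 \<le> t\<close>])
      fix r assume r: "r \<in> {0..t}"
      then have r1: "r \<in> {0..1}" using t by auto
      have "((\<lambda>r. w j * (cmod (u j r))\<^sup>2) has_real_derivative w j * (2 * (u j r \<bullet>
          (\<i> * (lattice_laplacian (\<lambda>l. u l r) j + V j r * u j r))))) (at r within {0..t})" for j
      proof -
        have d: "(u j has_vector_derivative (\<i> * (lattice_laplacian (\<lambda>l. u l r) j + V j r * u j r)))
            (at r within {0..t})"
          using eq r1 t unfolding lattice_equation_def
          by (intro has_vector_derivative_within_subset[of _ _ _ "{0..1}" "{0..t}"]) auto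
        show ?thesis
          unfolding power2_norm_eq_inner has_field_derivative_def
          by (rule has_derivative_eq_rhs[OF has_derivative_mult_right[OF
                has_derivative_inner[OF d[unfolded has_vector_derivative_def]
                  d[unfolded has_vector_derivative_def]]]])
             (auto simp: inner_commute algebra_simps)
      qed
      then have "(\<Phi> A has_real_derivative D r) (at r within {0..t})"
        unfolding \<Phi>_def D_def by (intro DERIV_sum)
      then show "((\<lambda>r. X / 2 * exp (4 * K * r) - \<Phi> A r) has_real_derivative
          2 * K * (X * exp (4 * K * r)) - D r) (at r within {0..t})"
        by (auto intro!: derivative_eq_intros)
      show "0 \<le> 2 * K * (X * exp (4 * K * r)) - D r"
        using deriv_le[OF A r1] by (simp add: D_def)
    qed
    then have "\<Phi> A t \<le> (X / 2) * exp (4 * K * t) - X / 2 + \<Phi> A 0" by simp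
    moreover have "\<Phi> A 0 \<le> s * exp (4 * K * t)"
    proof -
      have "\<Phi> A 0 \<le> s" using init[OF A] by (simp add: \<Phi>_def)
      also have "s * 1 \<le> s * exp (4 * K * t)"
        using init[of "{}"] K t by (intro mult_left_mono) auto
      finally show ?thesis by simp
    qed
    moreover have "0 \<le> X"
      using \<Phi>_le[of "{}" 0] by (simp add: \<Phi>_def)
    ultimately have "\<Phi> A t \<le> (s + X / 2) * exp (4 * K * t)"
      by (simp add: distrib_right)
    then show ?thesis by (simp add: exp_minus field_simps)
  qed
  have "X \<le> s + X / 2"
    unfolding X_def
  proof (rule cSup_least)
    show "S \<noteq> {}" using SI[of "{}" 0] by auto
    show "x \<le> s + Sup S / 2" if "x \<in> S" for x
      using that improve unfolding S_def X_def by blast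
  qed
  then have X: "X \<le> 2 * s" by simp
  have s0: "0 \<le> s" using init[of "{}"] by simp
  have "\<Phi> A t \<le> X * exp (4 * K * t)" by (rule \<Phi>_le[OF A t])
  also have "\<dots> \<le> (2 * s) * exp (4 * K)"
    using X s0 t K by (intro mult_mono) (auto intro: mult_left_le)
  finally show ?thesis by (simp add: \<Phi>_def K_def mult_ac)
qed

text \<open>For a given \<open>A\<close> the weight is truncated at a height \<open>N\<close> that
  it does not exceed on \<open>A\<close>. Truncation keeps the ratio condition because
  \<open>N \<le> L * N\<close>, which is where \<open>1 \<le> L\<close> is used, and the constant of
  the bounded case does not depend on \<open>N\<close>.\<close>

lemma weighted_bound:
  fixes u V :: "int ^ 'd::finite \<Rightarrow> real \<Rightarrow> complex" and w :: "int ^ 'd \<Rightarrow> real" and L m s :: real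
  assumes eq: "lattice_equation V u"
    and V: "\<And>j t. t \<in> {0..1} \<Longrightarrow> cmod (V j t) \<le> m"
    and B: "\<And>t A. t \<in> {0..1} \<Longrightarrow> finite A \<Longrightarrow> (\<Sum>j\<in>A. (cmod (u j t))\<^sup>2) \<le> B"
    and w: "\<And>j. 0 \<le> w j"
    and L: "\<And>j k. w j \<le> L * w (j + axis k 1)" "\<And>j k. w j \<le> L * w (j - axis k 1)" "1 \<le> L"
    and m: "0 \<le> m"
    and init: "\<And>A. finite A \<Longrightarrow> (\<Sum>j\<in>A. w j * (cmod (u j 0))\<^sup>2) \<le> s"
    and t: "t \<in> {0..1}" and A: "finite A"
  shows "(\<Sum>j\<in>A. w j * (cmod (u j t))\<^sup>2) \<le> 2 * exp (4 * (CARD('d) * (L + 1) + m)) * s"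
proof -
  define N where "N = (\<Sum>j\<in>A. w j)"
  have N: "w j \<le> N" if "j \<in> A" for j
    unfolding N_def using A w that by (intro member_le_sum) auto
  have N0: "0 \<le> N" unfolding N_def using w by (intro sum_nonneg) auto
  have "N \<le> L * N" using L(3) N0 mult_right_mono[of 1 L N] by simp
  have "(\<Sum>j\<in>A. w j * (cmod (u j t))\<^sup>2) = (\<Sum>j\<in>A. min (w j) N * (cmod (u j t))\<^sup>2)"
    using N by (intro sum.cong) auto
  also have "\<dots> \<le> 2 * exp (4 * (CARD('d) * (L + 1) + m)) * s"
  proof (rule weighted_bound_bounded_weight[OF eq V B, where W = N])
    show "0 \<le> min (w j) N" "min (w j) N \<le> N" for j using w N0 by auto
    show "min (w j) N \<le> L * min (w (j + axis k 1)) N" "min (w j) N \<le> L * min (w (j - axis k 1)) N" for j k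
      using L(1,2)[of j k] \<open>N \<le> L * N\<close> by (auto simp: min_def)
    fix F :: "(int ^ 'd) set" assume F: "finite F"
    have "(\<Sum>j\<in>F. min (w j) N * (cmod (u j 0))\<^sup>2) \<le> (\<Sum>j\<in>F. w j * (cmod (u j 0))\<^sup>2)"
      by (intro sum_mono mult_right_mono) auto
    then show "(\<Sum>j\<in>F. min (w j) N * (cmod (u j 0))\<^sup>2) \<le> s" using init[OF F] by simp
  qed (use L m t A in auto)
  finally show ?thesis .
qed

section \<open>Exponential weights and uniform tails\<close>

lemma finite_sum_abs_less:
  "finite {j :: int ^ 'd::finite. exp (\<Sum>i\<in>UNIV. \<bar>real_of_int (j $ i)\<bar>) < n}"
proof (cases "n > 0")
  case True
  define N where "N = \<lceil>ln n\<rceil>"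
  have "finite (PiE (UNIV::'d set) (\<lambda>_. {-N..N}))" by (intro finite_PiE) auto
  then have "finite (vec_nth -` (PiE (UNIV::'d set) (\<lambda>_. {-N..N})))"
    by (rule finite_vimageI) (simp add: inj_def vec_nth_inject)
  moreover have "{j :: int ^ 'd. exp (\<Sum>i\<in>UNIV. \<bar>real_of_int (j $ i)\<bar>) < n}
      \<subseteq> vec_nth -` (PiE (UNIV::'d set) (\<lambda>_. {-N..N}))"
  proof
    fix j :: "int ^ 'd" assume "j \<in> {j. exp (\<Sum>i\<in>UNIV. \<bar>real_of_int (j $ i)\<bar>) < n}"
    then have "(\<Sum>i\<in>UNIV. \<bar>real_of_int (j $ i)\<bar>) < ln n"
      using True by (metis exp_less_cancel_iff exp_ln mem_Collect_eq)
    moreover have "\<bar>real_of_int (j $ i)\<bar> \<le> (\<Sum>i\<in>UNIV. \<bar>real_of_int (j $ i)\<bar>)" for i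
      by (intro member_le_sum) auto
    ultimately have "\<bar>real_of_int (j $ i)\<bar> < ln n" for i
      by (rule le_less_trans[rotated])
    then have "\<bar>j $ i\<bar> \<le> N" for i
      unfolding N_def by (metis le_of_int_ceiling less_le_trans of_int_abs of_int_le_iff order_less_imp_le)
    then show "j \<in> vec_nth -` (PiE (UNIV::'d set) (\<lambda>_. {-N..N}))"
      by (auto simp: abs_le_iff minus_le_iff)
  qed
  ultimately show ?thesis by (rule finite_subset[rotated])
next
  case False
  then have "{j :: int ^ 'd::finite. exp (\<Sum>i\<in>UNIV. \<bar>real_of_int (j $ i)\<bar>) < n} = {}"
    by (auto simp: not_less intro: order_trans[OF _ exp_ge_zero])
  then show ?thesis by simp
qed

lemma summable_on_finite_tail:
  fixes c :: "'a \<Rightarrow> real"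
  assumes c: "c summable_on UNIV" "\<And>j. 0 \<le> c j" and e: "0 < e"
  obtains A where "finite A" "\<And>F. finite F \<Longrightarrow> F \<inter> A = {} \<Longrightarrow> sum c F \<le> e"
proof -
  have "(sum c \<longlongrightarrow> infsum c UNIV) (finite_subsets_at_top UNIV)"
    using has_sum_infsum[OF c(1)] by (simp add: has_sum_def)
  then have "\<forall>\<^sub>F A in finite_subsets_at_top UNIV. infsum c UNIV - e < sum c A"
    using e by (intro order_tendstoD) auto
  then obtain A where A: "finite A" "infsum c UNIV - e < sum c A"
    unfolding eventually_finite_subsets_at_top by auto
  have "sum c F \<le> e" if "finite F" "F \<inter> A = {}" for F
  proof -
    have "sum c (F \<union> A) \<le> infsum c UNIV"
      using that A c by (intro finite_sum_le_infsum) auto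
    then show ?thesis using A(2) that A(1) by (simp add: sum.union_disjoint)
  qed
  with A(1) show thesis by (rule that)
qed

text \<open>A step of length at most 1 changes the first factor by at most
  \<open>exp (2 * \<bar>\<beta>\<bar>)\<close> and the growing exponential by at most
  \<open>exp 1\<close>. Capping at 1 does not worsen the second ratio, so the bound is independent
  of \<open>n\<close>.\<close>

lemma exp_weight_ratio:
  fixes j l :: "int ^ 'd::finite" and n \<beta> :: real
  assumes jl: "(\<Sum>i\<in>UNIV. \<bar>real_of_int (j $ i) - real_of_int (l $ i)\<bar>) \<le> 1" and n: "n > 0"
  shows "exp (2 * \<beta> * (j $ k)) * min 1 (exp (\<Sum>i\<in>UNIV. \<bar>real_of_int (j $ i)\<bar>) / n)
    \<le> exp (2 * \<bar>\<beta>\<bar> + 1) * (exp (2 * \<beta> * (l $ k)) * min 1 (exp (\<Sum>i\<in>UNIV. \<bar>real_of_int (l $ i)\<bar>) / n))"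
proof -
  define r where "r m = exp (\<Sum>i\<in>UNIV. \<bar>real_of_int (m $ i)\<bar>)" for m :: "int ^ 'd"
  have "(\<Sum>i\<in>UNIV. \<bar>real_of_int (j $ i)\<bar>) \<le>
      (\<Sum>i\<in>UNIV. \<bar>real_of_int (j $ i) - real_of_int (l $ i)\<bar> + \<bar>real_of_int (l $ i)\<bar>)"
    by (intro sum_mono) simp
  then have "r j \<le> exp (1 + (\<Sum>i\<in>UNIV. \<bar>real_of_int (l $ i)\<bar>))"
    using jl unfolding r_def by (simp add: sum.distrib)
  then have r: "r j \<le> exp 1 * r l" by (simp add: r_def exp_add)
  have "min 1 (r j / n) \<le> min (exp 1) (exp 1 * r l / n)"
    using r n by (intro min.mono divide_right_mono) auto
  also have "\<dots> = exp 1 * min 1 (r l / n)"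
    by (simp add: min_mult_distrib_left)
  finally have 1: "min 1 (r j / n) \<le> exp 1 * min 1 (r l / n)" .
  have "\<bar>real_of_int (j $ k) - real_of_int (l $ k)\<bar> \<le> (\<Sum>i\<in>UNIV. \<bar>real_of_int (j $ i) - real_of_int (l $ i)\<bar>)"
    by (intro member_le_sum) auto
  then have "\<bar>real_of_int (j $ k) - real_of_int (l $ k)\<bar> \<le> 1"
    using jl by simp
  then have "\<bar>\<beta>\<bar> * \<bar>real_of_int (j $ k) - real_of_int (l $ k)\<bar> \<le> \<bar>\<beta>\<bar> * 1"
    by (intro mult_left_mono) auto
  then have "\<beta> * (real_of_int (j $ k) - real_of_int (l $ k)) \<le> \<bar>\<beta>\<bar>"
    unfolding abs_mult[symmetric] by simp
  then have "exp (2 * \<beta> * (j $ k)) \<le> exp (2 * \<bar>\<beta>\<bar> + 2 * \<beta> * (l $ k))"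
    by (simp add: algebra_simps)
  then have 2: "exp (2 * \<beta> * (j $ k)) \<le> exp (2 * \<bar>\<beta>\<bar>) * exp (2 * \<beta> * (l $ k))"
    by (simp add: exp_add)
  have "exp (2 * \<beta> * (j $ k)) * min 1 (r j / n)
      \<le> (exp (2 * \<bar>\<beta>\<bar>) * exp (2 * \<beta> * (l $ k))) * (exp 1 * min 1 (r l / n))"
    using n by (intro mult_mono 1 2) (auto simp: r_def)
  then show ?thesis unfolding r_def by (simp add: exp_add mult_ac)
qed

text \<open>The weights \<open>exp (2\<beta>j\<^sub>1) * min 1 (exp \<bar>j\<bar> / n)\<close> have ratios bounded uniformly in \<open>n\<close>, agree
  with \<open>exp (2\<beta>j\<^sub>1)\<close> outside a finite set and make the initial sum small for large \<open>n\<close>.\<close>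

lemma unif_sq_summable_exp_weight:
  fixes u V :: "int ^ 'd::finite \<Rightarrow> real \<Rightarrow> complex" and \<beta> m :: real
  assumes eq: "lattice_equation V u"
    and V: "\<And>j t. t \<in> {0..1} \<Longrightarrow> cmod (V j t) \<le> m"
    and B: "\<And>t A. t \<in> {0..1} \<Longrightarrow> finite A \<Longrightarrow> (\<Sum>j\<in>A. (cmod (u j t))\<^sup>2) \<le> B"
    and m: "0 \<le> m"
    and init: "(\<lambda>j. exp (2 * \<beta> * (j $ k)) * (cmod (u j 0))\<^sup>2) summable_on UNIV"
  shows "unif_sq_summable {0..1} (\<lambda>j t. of_real (exp (\<beta> * (j $ k))) * u j t)"
  unfolding unif_sq_summable_def
proof (intro allI impI)
  fix e :: real assume "e > 0"
  define L where "L = exp (2 * \<bar>\<beta>\<bar> + 1)"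
  define C where "C = 2 * exp (4 * (CARD('d) * (L + 1) + m))"
  have C: "C > 0" unfolding C_def by simp
  \<comment> \<open>The initial weighted sum is to be at most \<open>s\<close>, so that the Gronwall
    constant \<open>C\<close> turns it into e. As \<open>C\<close> does not depend on
    \<open>n\<close>, \<open>n\<close> can still be chosen afterwards.\<close>
  define s where "s = e / C"
  have s: "s > 0" using \<open>e > 0\<close> C by (simp add: s_def)
  define c where "c j = exp (2 * \<beta> * (j $ k)) * (cmod (u j 0))\<^sup>2" for j
  have c0: "0 \<le> c j" for j unfolding c_def by simp
  define r where "r j = exp (\<Sum>i\<in>UNIV. \<bar>real_of_int (j $ i)\<bar>)" for j :: "int ^ 'd"
  have r0: "r j > 0" for j unfolding r_def by simp
  obtain A where A: "finite A" "\<And>F. finite F \<Longrightarrow> F \<inter> A = {} \<Longrightarrow> sum c F \<le> s / 2"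
    using summable_on_finite_tail[of c "s / 2"] init s c0 unfolding c_def by auto
  define M where "M = (\<Sum>j\<in>A. c j * r j)"
  have M0: "0 \<le> M" unfolding M_def using c0 r0 by (intro sum_nonneg mult_nonneg_nonneg) (auto intro: less_imp_le)
  define n where "n = 1 + 2 * M / s"
  have n: "n > 0" "M / n \<le> s / 2"
    using M0 s by (auto simp: n_def add_pos_nonneg field_simps)
  define w where "w j = exp (2 * \<beta> * (j $ k)) * min 1 (r j / n)" for j
  have w0: "0 \<le> w j" for j unfolding w_def using n r0[of j] by simp
  \<comment> \<open>On \<open>A\<close> the bound \<open>r j / n\<close> for the minimum is used and
    contributes at most M/n; off \<open>A\<close> the bound 1 is used and leaves a tail of the
    convergent initial sum. Each part is at most s/2.\<close>
  have init': "(\<Sum>j\<in>F. w j * (cmod (u j 0))\<^sup>2) \<le> s" if F: "finite F" for F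
  proof -
    have w1: "w j * (cmod (u j 0))\<^sup>2 \<le> c j" for j
    proof -
      have "w j \<le> exp (2 * \<beta> * (j $ k))" unfolding w_def by (intro mult_left_le) auto
      then show ?thesis unfolding c_def by (intro mult_right_mono) auto
    qed
    have w2: "w j * (cmod (u j 0))\<^sup>2 \<le> c j * r j / n" for j
    proof -
      have "w j \<le> exp (2 * \<beta> * (j $ k)) * (r j / n)" unfolding w_def by (intro mult_left_mono) auto
      then have "w j * (cmod (u j 0))\<^sup>2 \<le> exp (2 * \<beta> * (j $ k)) * (r j / n) * (cmod (u j 0))\<^sup>2"
        by (intro mult_right_mono) auto
      then show ?thesis unfolding c_def by (simp add: mult_ac)
    qed
    have "(\<Sum>j\<in>F. w j * (cmod (u j 0))\<^sup>2)
        = (\<Sum>j\<in>F \<inter> A. w j * (cmod (u j 0))\<^sup>2) + (\<Sum>j\<in>F - A. w j * (cmod (u j 0))\<^sup>2)"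
      using F by (rule sum.Int_Diff)
    also have "(\<Sum>j\<in>F \<inter> A. w j * (cmod (u j 0))\<^sup>2) \<le> (\<Sum>j\<in>F \<inter> A. c j * r j / n)"
      by (intro sum_mono w2)
    also have "\<dots> \<le> (\<Sum>j\<in>A. c j * r j / n)"
      using A c0 r0 n by (intro sum_mono2) (auto simp: less_imp_le)
    also have "\<dots> = M / n" by (simp add: M_def sum_divide_distrib)
    also have "\<dots> \<le> s / 2" by (rule n)
    also have "(\<Sum>j\<in>F - A. w j * (cmod (u j 0))\<^sup>2) \<le> sum c (F - A)"
      by (intro sum_mono w1)
    also have "\<dots> \<le> s / 2" using F by (intro A(2)) auto
    finally show ?thesis by simp
  qed
  have "(\<Sum>i\<in>UNIV. \<bar>real_of_int ((axis k' 1 :: int ^ 'd) $ i)\<bar>) = 1" for k'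
    by (subst sum.cong[OF refl, of _ _ "\<lambda>i. if i = k' then 1 else 0"]) (auto simp: axis_def)
  then have ratio: "w j \<le> L * w (j + axis k' 1)" "w j \<le> L * w (j - axis k' 1)" for j k'
    unfolding w_def r_def L_def by (intro exp_weight_ratio n; simp)+
  show "\<exists>A. finite A \<and> (\<forall>t\<in>{0..1}. \<forall>F. finite F \<longrightarrow> F \<inter> A = {} \<longrightarrow>
      (\<Sum>j\<in>F. (norm (of_real (exp (\<beta> * (j $ k))) * u j t))\<^sup>2) \<le> e)"
  \<comment> \<open>Outside this finite set the minimum is 1, so the weight there is the full
    exponential.\<close>
  proof (intro exI[of _ "{j. r j < n}"] conjI ballI allI impI)
    show "finite {j. r j < n}" unfolding r_def by (rule finite_sum_abs_less)
    fix t :: real and F assume t: "t \<in> {0..1}" and F: "finite F" "F \<inter> {j. r j < n} = {}"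
    have "(\<Sum>j\<in>F. (norm (of_real (exp (\<beta> * (j $ k))) * u j t))\<^sup>2) = (\<Sum>j\<in>F. w j * (cmod (u j t))\<^sup>2)"
    proof (rule sum.cong[OF refl])
      fix j assume "j \<in> F"
      then have "n \<le> r j" using F(2) by (auto simp: not_less[symmetric])
      then have "w j = exp (2 * (\<beta> * (j $ k)))" using n by (simp add: w_def)
      then show "(norm (of_real (exp (\<beta> * (j $ k))) * u j t))\<^sup>2 = w j * (cmod (u j t))\<^sup>2"
        by (simp add: norm_mult power_mult_distrib exp_double)
    qed
    also have "\<dots> \<le> C * s"
      unfolding C_def
    proof (rule weighted_bound[OF eq V B w0 ratio _ m init' t F(1)])
      show "1 \<le> L" unfolding L_def by simp
    qed
    also have "\<dots> = e" using C by (simp add: s_def)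
    finally show "(\<Sum>j\<in>F. (norm (of_real (exp (\<beta> * (j $ k))) * u j t))\<^sup>2) \<le> e" .
  qed
qed

section \<open>Symmetric and skew parts of the conjugated operator\<close>

text \<open>The difference of the two shifts is skew, and so is multiplication by i; as they
  commute, their product is symmetric. Conjugation by the exponential weight yields
  \<open>\<sigma> = sinh \<beta>\<close>, with \<open>e\<close> the first basis vector.\<close>

definition sym_part :: "real \<Rightarrow> 'a::ab_group_add \<Rightarrow> ('a \<Rightarrow> 't \<Rightarrow> complex) \<Rightarrow> 'a \<Rightarrow> 't \<Rightarrow> complex" where
  "sym_part \<sigma> e w j t = \<sigma> *\<^sub>R (\<i> * (w (j - e) t - w (j + e) t))"

text \<open>Here the sum of the two shifts is symmetric, and multiplication by i makes it skew. The
  coefficient is \<open>cosh \<beta>\<close> in the weighted direction and 1 in the others.\<close>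

definition skew_part :: "('k \<Rightarrow> real) \<Rightarrow> ('k \<Rightarrow> 'a::ab_group_add) \<Rightarrow> ('a \<Rightarrow> 't \<Rightarrow> complex) \<Rightarrow> 'a \<Rightarrow> 't \<Rightarrow> complex" where
  "skew_part c e w j t = (\<Sum>k\<in>UNIV. c k *\<^sub>R (\<i> * (w (j + e k) t + w (j - e k) t)) - 2 *\<^sub>R (\<i> * w j t))"

lemma unif_sq_summable_sym_part:
  "unif_sq_summable T w \<Longrightarrow> unif_sq_summable T (sym_part \<sigma> e w)"
  unfolding sym_part_def[abs_def]
  by (intro unif_sq_summable_intros)

lemma unif_sq_summable_skew_part:
  "unif_sq_summable T w \<Longrightarrow> unif_sq_summable T (skew_part c e w)"
  unfolding skew_part_def[abs_def]
  by (intro unif_sq_summable_intros)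

lemma sym_part_symmetric:
  assumes a: "unif_sq_summable T a" and b: "unif_sq_summable T b" and t: "t \<in> T"
  shows "l2_inner a (sym_part \<sigma> e b) t = l2_inner (sym_part \<sigma> e a) b t"
proof -
  have "l2_inner a (\<lambda>j t. b (j - e) t - b (j + e) t) t = - l2_inner (\<lambda>j t. a (j - e) t - a (j + e) t) b t"
    if "unif_sq_summable T a" for a
    using that b t
    by (simp add: l2_inner_diff_right[OF t] l2_inner_diff_left[OF t] unif_sq_summable_shift
        unif_sq_summable_shift_diff l2_inner_shift l2_inner_shift_diff)
  from this[of "\<lambda>j t. \<i> * a j t"] show ?thesis
    unfolding sym_part_def[abs_def]
    by (simp add: l2_inner_scaleR_left l2_inner_scaleR_right l2_inner_mult_ii
        unif_sq_summable_mult a flip: right_diff_distrib)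
qed

lemma skew_part_skew:
  assumes a: "unif_sq_summable T a" and b: "unif_sq_summable T b" and t: "t \<in> T"
  shows "l2_inner a (skew_part c e b) t = - l2_inner (skew_part c e a) b t"
proof -
  have shifts: "l2_inner a (\<lambda>j t. b (j + d) t + b (j - d) t) t = l2_inner (\<lambda>j t. a (j + d) t + a (j - d) t) b t"
    if "unif_sq_summable T a" for a d
    using that b t
    by (simp add: l2_inner_add_right[OF t] l2_inner_add_left[OF t] unif_sq_summable_shift
        unif_sq_summable_shift_diff l2_inner_shift l2_inner_shift_diff)
  have single: "l2_inner a (\<lambda>j t. c k *\<^sub>R (\<i> * (b (j + e k) t + b (j - e k) t)) - 2 *\<^sub>R (\<i> * b j t)) t
      = - l2_inner (\<lambda>j t. c k *\<^sub>R (\<i> * (a (j + e k) t + a (j - e k) t)) - 2 *\<^sub>R (\<i> * a j t)) b t" for k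
    using shifts[of "\<lambda>j t. \<i> * a j t" "e k"]
    by (subst l2_inner_diff_right[OF t], (intro unif_sq_summable_intros a b)+,
        subst l2_inner_diff_left[OF t], (intro unif_sq_summable_intros a b)+)
       (simp add: l2_inner_scaleR_left l2_inner_scaleR_right l2_inner_mult_ii
        unif_sq_summable_mult a flip: distrib_left)
  show ?thesis
    unfolding skew_part_def[abs_def]
    by (subst l2_inner_sum_right[OF t a], (intro unif_sq_summable_intros a b)+,
        subst l2_inner_sum_left[OF t b], (intro unif_sq_summable_intros a b)+)
       (simp add: single sum_negf)
qed

text \<open>Both operators are combinations of translations and multiplication by i with constant
  coefficients.\<close>

lemma sym_skew_commute:
  "sym_part \<sigma> e (skew_part c d w) = skew_part c d (sym_part \<sigma> e w)"
proof (intro ext)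
  fix j t
  have [simp]: "j - e + x = j + x - e" "j + e + x = j + x + e" "j - e - x = j - x - e" "j + e - x = j - x + e" for x
    by (simp_all add: algebra_simps)
  show "sym_part \<sigma> e (skew_part c d w) j t = skew_part c d (sym_part \<sigma> e w) j t"
    unfolding sym_part_def skew_part_def sum_subtractf[symmetric] sum_distrib_left scaleR_sum_right
    by (intro sum.cong refl) (simp add: scaleR_conv_of_real algebra_simps)
qed

text \<open>Symmetry, commutation and skewness show that the pairing equals its own negative. Thus
  no commutator term appears in the derivative of the pairing of v with Sv.\<close>

lemma sym_part_skew_part_orthogonal:
  assumes w: "unif_sq_summable T w" and t: "t \<in> T"
  shows "l2_inner (sym_part \<sigma> e w) (skew_part c d w) t = 0"
proof -
  have "l2_inner (sym_part \<sigma> e w) (skew_part c d w) t = l2_inner w (sym_part \<sigma> e (skew_part c d w)) t"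
    by (rule sym_part_symmetric[OF w unif_sq_summable_skew_part[OF w] t, symmetric])
  also have "\<dots> = - l2_inner (sym_part \<sigma> e w) (skew_part c d w) t"
    unfolding sym_skew_commute
    by (simp add: skew_part_skew[OF w unif_sq_summable_sym_part[OF w] t] l2_inner_commute)
  finally show ?thesis by simp
qed

lemma skew_part_self_orthogonal:
  assumes w: "unif_sq_summable T w" and t: "t \<in> T"
  shows "l2_inner w (skew_part c d w) t = 0"
  using skew_part_skew[OF w w t, of c d] by (simp add: l2_inner_commute)

lemma l2_inner_le_add:
  assumes a: "unif_sq_summable T a" and b: "unif_sq_summable T b" and t: "t \<in> T"
  shows "\<bar>l2_inner a b t\<bar> \<le> l2_inner a a t + l2_inner b b t"
proof -
  have "0 \<le> l2_inner a a t + l2_inner b b t + 2 * l2_inner a b t"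
    using l2_inner_self_nonneg[of "\<lambda>j t. a j t + b j t" t] a b
    by (simp add: l2_inner_add_right[OF t] l2_inner_add_left[OF t] unif_sq_summable_add
        l2_inner_commute[of b a])
  moreover have "0 \<le> l2_inner a a t + l2_inner b b t - 2 * l2_inner a b t"
    using l2_inner_self_nonneg[of "\<lambda>j t. a j t - b j t" t] a b
    by (simp add: l2_inner_diff_right[OF t] l2_inner_diff_left[OF t] unif_sq_summable_diff
        l2_inner_commute[of b a])
  moreover have "0 \<le> l2_inner a a t" "0 \<le> l2_inner b b t" by (rule l2_inner_self_nonneg)+
  ultimately show ?thesis by linarith
qed

text \<open>Shifts and multiplication by i preserve the norm, so each shifted pairing is at most
  twice the squared norm. The constant is not sharp; only its finiteness matters for the convexity
  argument.\<close>

lemma sym_part_bounded: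
  assumes w: "unif_sq_summable T w" and t: "t \<in> T"
  shows "\<bar>l2_inner w (sym_part \<sigma> e w) t\<bar> \<le> 4 * \<bar>\<sigma>\<bar> * l2_inner w w t"
proof -
  have ii: "l2_inner (\<lambda>j t. \<i> * b j t) (\<lambda>j t. \<i> * b j t) t = l2_inner b b t" for b :: "'b \<Rightarrow> 'a \<Rightarrow> complex"
    unfolding l2_inner_def by (simp add: inner_complex_def add.commute)
  have 1: "\<bar>l2_inner w (\<lambda>j t. \<i> * w (j - e) t) t\<bar> \<le> 2 * l2_inner w w t"
    using l2_inner_le_add[OF w _ t, of "\<lambda>j t. \<i> * w (j - e) t"] w
    by (simp add: unif_sq_summable_intros ii l2_inner_shift_diff)
  have 2: "\<bar>l2_inner w (\<lambda>j t. \<i> * w (j + e) t) t\<bar> \<le> 2 * l2_inner w w t"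
    using l2_inner_le_add[OF w _ t, of "\<lambda>j t. \<i> * w (j + e) t"] w
    by (simp add: unif_sq_summable_intros ii l2_inner_shift)
  have "l2_inner w (sym_part \<sigma> e w) t
      = \<sigma> * (l2_inner w (\<lambda>j t. \<i> * w (j - e) t) t - l2_inner w (\<lambda>j t. \<i> * w (j + e) t) t)"
    unfolding sym_part_def[abs_def] l2_inner_scaleR_right right_diff_distrib[of \<i>]
    by (subst l2_inner_diff_right[OF t]) (intro unif_sq_summable_intros w refl)+
  then have "\<bar>l2_inner w (sym_part \<sigma> e w) t\<bar>
      = \<bar>\<sigma>\<bar> * \<bar>l2_inner w (\<lambda>j t. \<i> * w (j - e) t) t - l2_inner w (\<lambda>j t. \<i> * w (j + e) t) t\<bar>"
    by (simp add: abs_mult)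
  also have "\<dots> \<le> \<bar>\<sigma>\<bar> * (4 * l2_inner w w t)"
    using 1 2 by (intro mult_left_mono) auto
  finally show ?thesis by simp
qed

section \<open>Passage between real and extended nonnegative sums\<close>

lemma infsum_ennreal:
  fixes f :: "'a \<Rightarrow> real"
  assumes "f summable_on UNIV" "\<And>j. 0 \<le> f j"
  shows "(\<Sum>\<^sub>\<infinity>j. ennreal (f j)) = ennreal (infsum f UNIV)"
  using assms
  by (simp add: infsum_nonneg_is_SUPREMUM_ennreal nonneg_infsum_complete)

lemma sum_le_infsum_ennreal:
  fixes f :: "'a \<Rightarrow> real"
  assumes "finite F" "\<And>j. 0 \<le> f j"
  shows "ennreal (sum f F) \<le> (\<Sum>\<^sub>\<infinity>j. ennreal (f j))"
  using assms SUP_upper[of F "{F. finite F \<and> F \<subseteq> UNIV}" "sum (\<lambda>j. ennreal (f j))"]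
  by (simp add: nonneg_infsum_complete)

lemma summable_on_if_infsum_ennreal_finite:
  fixes f :: "'a \<Rightarrow> real"
  assumes fin: "(\<Sum>\<^sub>\<infinity>j. ennreal (f j)) \<noteq> \<infinity>" and f: "\<And>j. 0 \<le> f j"
  shows "f summable_on UNIV"
proof (rule nonneg_bdd_above_summable_on)
  obtain B where B: "0 \<le> B" "(\<Sum>\<^sub>\<infinity>j. ennreal (f j)) = ennreal B"
    using fin by (cases "\<Sum>\<^sub>\<infinity>j. ennreal (f j)") auto
  have "sum f F \<le> B" if "finite F" for F
    using sum_le_infsum_ennreal[of F f, OF that f] B by simp
  then show "bdd_above (sum f ` {F. F \<subseteq> UNIV \<and> finite F})"
    by (auto simp: bdd_above_def)
qed (rule f)

section \<open>The conjugated equation and its convexity\<close>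

text \<open>In terms of v, the forward neighbour in direction \<open>k1\<close> gets the coefficient
  \<open>exp (- \<beta>)\<close>, which is cosh - sinh, and the backward one
  \<open>exp \<beta>\<close>, which is cosh + sinh. The sinh terms form the symmetric part and the
  cosh terms go into the skew part.\<close>

lemma exp_conjugated_schroedinger:
  fixes V u :: "int ^ 'd::finite \<Rightarrow> real \<Rightarrow> complex" and \<beta> :: real and k1 :: 'd
  defines "v \<equiv> \<lambda>j t. of_real (exp (\<beta> * (j $ k1))) * u j t"
  shows "of_real (exp (\<beta> * (j $ k1))) * (\<i> * (lattice_laplacian (\<lambda>l. u l t) j + V j t * u j t)) =
    sym_part (sinh \<beta>) (axis k1 1) v j t
      + skew_part (\<lambda>k. if k = k1 then cosh \<beta> else 1) (\<lambda>k. axis k 1) v j t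
      + \<i> * V j t * v j t"
proof -
  define E where "E = complex_of_real (exp (\<beta> * (j $ k1)))"
  have v0: "v j t = E * u j t" by (simp add: v_def E_def)
  have vp: "v (j + axis k 1) t = E * (if k = k1 then of_real (exp \<beta>) else 1) * u (j + axis k 1) t" for k
    by (simp add: v_def E_def axis_def distrib_left exp_add)
  have vm: "v (j - axis k 1) t = E * (if k = k1 then of_real (exp (- \<beta>)) else 1) * u (j - axis k 1) t" for k
    by (simp add: v_def E_def axis_def right_diff_distrib exp_diff exp_minus field_simps)
  have "exp \<beta> * (cosh \<beta> - sinh \<beta>) = 1" "exp (- \<beta>) * (cosh \<beta> + sinh \<beta>) = 1"
    by (simp_all add: cosh_minus_sinh cosh_plus_sinh flip: exp_add)
  then have one: "complex_of_real (exp \<beta>) * (of_real (cosh \<beta>) - of_real (sinh \<beta>)) = 1"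
    "complex_of_real (exp (- \<beta>)) * (of_real (cosh \<beta>) + of_real (sinh \<beta>)) = 1"
    by (metis of_real_1 of_real_diff of_real_mult) (metis \<open>exp (- \<beta>) * (cosh \<beta> + sinh \<beta>) = 1\<close> of_real_1 of_real_add of_real_mult)
  have summand: "E * (\<i> * (u (j + axis k 1) t - 2 * u j t + u (j - axis k 1) t)) =
      (if k = k1 then sinh \<beta> *\<^sub>R (\<i> * (v (j - axis k 1) t - v (j + axis k 1) t)) else 0) +
      ((if k = k1 then cosh \<beta> else 1) *\<^sub>R (\<i> * (v (j + axis k 1) t + v (j - axis k 1) t)) - 2 *\<^sub>R (\<i> * v j t))" for k
  proof (cases "k = k1")
    case True
    have "sinh \<beta> *\<^sub>R (\<i> * (v (j - axis k 1) t - v (j + axis k 1) t)) +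
        (cosh \<beta> *\<^sub>R (\<i> * (v (j + axis k 1) t + v (j - axis k 1) t)) - 2 *\<^sub>R (\<i> * v j t))
      = E * (\<i> * ((complex_of_real (exp \<beta>) * (of_real (cosh \<beta>) - of_real (sinh \<beta>))) * u (j + axis k 1) t
          - 2 * u j t
          + (complex_of_real (exp (- \<beta>)) * (of_real (cosh \<beta>) + of_real (sinh \<beta>))) * u (j - axis k 1) t))"
      unfolding vp vm v0 using True by (simp add: scaleR_conv_of_real algebra_simps)
    then show ?thesis unfolding one using True by simp
  next
    case False
    then show ?thesis unfolding vp vm v0 by (simp add: scaleR_conv_of_real algebra_simps)
  qed
  have "E * (\<i> * lattice_laplacian (\<lambda>l. u l t) j) =
      (\<Sum>k\<in>UNIV. E * (\<i> * (u (j + axis k 1) t - 2 * u j t + u (j - axis k 1) t)))"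
    unfolding lattice_laplacian_def by (simp add: sum_distrib_left)
  also have "\<dots> = sym_part (sinh \<beta>) (axis k1 1) v j t
      + skew_part (\<lambda>k. if k = k1 then cosh \<beta> else 1) (\<lambda>k. axis k 1) v j t"
    unfolding summand sum.distrib sym_part_def skew_part_def by simp
  finally show ?thesis
    unfolding E_def[symmetric] v0 by (simp add: distrib_left mult_ac)
qed

lemma exp_weight_convexity:
  fixes V u :: "int ^ 'd::finite \<Rightarrow> real \<Rightarrow> complex" and \<beta> m :: real and k1 :: 'd
  defines "v \<equiv> \<lambda>j t. of_real (exp (\<beta> * (j $ k1))) * u j t"
  assumes eq: "lattice_equation V u"
    and V: "\<And>j t. t \<in> {0..1} \<Longrightarrow> cmod (V j t) \<le> m"
    and m: "0 \<le> m"
    and v: "unif_sq_summable {0..1} v"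
    and t: "t \<in> {0..1}"
  shows "l2_inner v v t \<le> exp (2 * m + m\<^sup>2) * (l2_inner v v 0 + l2_inner v v 1)"
proof -
  define S where "S = sym_part (sinh \<beta>) (axis k1 1 :: int ^ 'd) v"
  define A where "A = skew_part (\<lambda>k. if k = k1 then cosh \<beta> else 1) (\<lambda>k. axis k 1 :: int ^ 'd) v"
  define F where "F j t = \<i> * V j t * v j t" for j t
  define v' where "v' j t = S j t + A j t + F j t" for j t
  have uS: "unif_sq_summable {0..1} S" unfolding S_def by (rule unif_sq_summable_sym_part[OF v])
  have uA: "unif_sq_summable {0..1} A" unfolding A_def by (rule unif_sq_summable_skew_part[OF v])
  have F_le: "norm (F j s) \<le> m * norm (v j s)" if "s \<in> {0..1}" for j s
    unfolding F_def using V[OF that] by (simp add: norm_mult mult_right_mono)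
  have uF: "unif_sq_summable {0..1} F"
    by (rule unif_sq_summable_bounded_multiple[OF v m F_le])
  have uv': "unif_sq_summable {0..1} v'"
    unfolding v'_def[abs_def] by (intro unif_sq_summable_add uS uA uF)
  have dv: "(v j has_vector_derivative v' j s) (at s within {0..1})" if "s \<in> {0..1}" for j s
  proof -
    have "(v j has_vector_derivative of_real (exp (\<beta> * (j $ k1))) *
        (\<i> * (lattice_laplacian (\<lambda>l. u l s) j + V j s * u j s))) (at s within {0..1})"
      unfolding v_def using eq that unfolding lattice_equation_def
      by (intro has_vector_derivative_mult_right) auto
    then show ?thesis
      unfolding exp_conjugated_schroedinger v'_def S_def A_def F_def v_def by simp
  qed
  \<comment> \<open>The coefficients of S do not depend on time, so the derivative of Sv is S
    applied to the derivative of v.\<close>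
  define S' where "S' = sym_part (sinh \<beta>) (axis k1 1 :: int ^ 'd) v'"
  have uS': "unif_sq_summable {0..1} S'" unfolding S'_def by (rule unif_sq_summable_sym_part[OF uv'])
  have dS: "(S j has_vector_derivative S' j s) (at s within {0..1})" if "s \<in> {0..1}" for j s
  proof -
    have "((\<lambda>t. sinh \<beta> *\<^sub>R (\<i> * (v (j - axis k1 1) t - v (j + axis k1 1) t))) has_vector_derivative S' j s)
        (at s within {0..1})"
      unfolding S'_def sym_part_def scaleR_conv_of_real
      by (intro has_vector_derivative_mult_right has_vector_derivative_diff dv that)
    then show ?thesis by (simp add: S_def sym_part_def[abs_def])
  qed
  have v'_right: "l2_inner w v' s = l2_inner w S s + l2_inner w A s + l2_inner w F s"
    if "s \<in> {0..1}" "unif_sq_summable {0..1} w" for s w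
    unfolding v'_def[abs_def] using that uS uA uF
    by (simp add: l2_inner_add_right[OF that(1)] unif_sq_summable_add)
  show ?thesis
  proof (rule log_convexity_bound[where H = "l2_inner v v" and G = "l2_inner v S"
        and P = "l2_inner S S" and f = "l2_inner v F" and g = "l2_inner S F"
        and K = "4 * \<bar>sinh \<beta>\<bar>"])
    fix s :: real assume s: "s \<in> {0..1}"
    have "l2_inner v A s = 0"
      unfolding A_def by (rule skew_part_self_orthogonal[OF v s])
    then have "l2_inner v' v s + l2_inner v v' s = 2 * l2_inner v S s + 2 * l2_inner v F s"
      by (simp add: v'_right[OF s v] l2_inner_commute[of v'])
    then show "(l2_inner v v has_real_derivative 2 * l2_inner v S s + 2 * l2_inner v F s) (at s within {0..1})"
      using l2_inner_has_real_derivative[OF _ dv dv v uv' v uv' s] by simp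
    have "l2_inner S A s = 0"
      unfolding S_def A_def by (rule sym_part_skew_part_orthogonal[OF v s])
    \<comment> \<open>By symmetry both terms of the product rule equal the pairing of Sv with v', in
      which the skew part drops out.\<close>
    moreover have "l2_inner v S' s = l2_inner S v' s"
      unfolding S'_def S_def by (rule sym_part_symmetric[OF v uv' s])
    ultimately have "l2_inner v' S s + l2_inner v S' s = 2 * l2_inner S S s + 2 * l2_inner S F s"
      by (simp add: v'_right[OF s uS] l2_inner_commute[of v'])
    then show "(l2_inner v S has_real_derivative 2 * l2_inner S S s + 2 * l2_inner S F s) (at s within {0..1})"
      using l2_inner_has_real_derivative[OF _ dv dS v uv' uS uS' s] by simp
    show "0 \<le> l2_inner v v s" by (rule l2_inner_self_nonneg)
    show "\<bar>l2_inner v F s\<bar> \<le> m * l2_inner v v s"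
      by (rule l2_inner_abs_le[OF v uF s F_le[OF s]])
    show "\<bar>l2_inner v S s\<bar> \<le> 4 * \<bar>sinh \<beta>\<bar> * l2_inner v v s"
      unfolding S_def by (rule sym_part_bounded[OF v s])
    fix N :: real
    \<comment> \<open>The half of F makes the cross terms of the square match the F terms in the
      derivative of the frequency; its own square costs only m^2/4 times \<open>H\<close>.\<close>
    define z where "z j t = (S j t - N *\<^sub>R v j t) + (1/2) *\<^sub>R F j t" for j t
    have uz: "unif_sq_summable {0..1} z"
      unfolding z_def[abs_def] by (intro unif_sq_summable_intros uS v uF)
    have z_right: "l2_inner w z s = l2_inner w S s - N * l2_inner w v s + (1/2) * l2_inner w F s"
      if "unif_sq_summable {0..1} w" for w
      unfolding z_def[abs_def] using that uS v uF
      by (simp only: l2_inner_add_right[OF s] l2_inner_diff_right[OF s] unif_sq_summable_intros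
          l2_inner_scaleR_right)
    have "0 \<le> l2_inner z z s" by (rule l2_inner_self_nonneg)
    also have "l2_inner z z s = l2_inner S S s - 2 * N * l2_inner v S s + N\<^sup>2 * l2_inner v v s
        + l2_inner S F s - N * l2_inner v F s + l2_inner F F s / 4"
      unfolding z_right[OF uz] l2_inner_commute[of z S] l2_inner_commute[of z v]
        l2_inner_commute[of z F] z_right[OF uS] z_right[OF v] z_right[OF uF]
      by (simp add: l2_inner_commute[of F S] l2_inner_commute[of F v] l2_inner_commute[of S v]
          algebra_simps power2_eq_square)
    also have "l2_inner F F s \<le> m\<^sup>2 * l2_inner v v s"
      by (rule l2_inner_self_le[OF v uF s F_le[OF s]])
    finally show "0 \<le> l2_inner S S s - 2 * N * l2_inner v S s + N\<^sup>2 * l2_inner v v s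
        + l2_inner S F s - N * l2_inner v F s + m\<^sup>2 / 4 * l2_inner v v s" by simp
  qed (use m t in auto)
qed

section \<open>The estimate for solutions\<close>

lemma norm_le_potential_norm:
  assumes "bounded_potential V" "t \<in> {0..1}"
  shows "cmod (V j t) \<le> potential_norm V"
  using cSUP_upper[of "(j, t)" "UNIV \<times> {0..1}" "\<lambda>(j, t). cmod (V j t)"] assms
  unfolding potential_norm_def bounded_potential_def by auto

lemma potential_norm_nonneg:
  assumes "bounded_potential V"
  shows "0 \<le> potential_norm V"
  by (rule order_trans[OF norm_ge_zero norm_le_potential_norm[OF assms, of 0 undefined]]) simp

text \<open>If the right-hand side is infinite, there is nothing to prove, because the exponential
  factor is positive. Otherwise the weighted sum at time 0 converges, and the uniform tails follow
  from it.\<close>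

lemma exp_weighted_bound:
  fixes V u :: "int ^ 'd::finite \<Rightarrow> real \<Rightarrow> complex" and \<beta> :: real and k1 :: 'd
  assumes V: "bounded_potential V" and u: "schroedinger_solution V u" and t: "t \<in> {0..1}"
  shows "(\<Sum>\<^sub>\<infinity>j. ennreal (exp (2 * \<beta> * real_of_int (j $ k1)) * (cmod (u j t))\<^sup>2))
      \<le> ennreal (exp (2 * potential_norm V + (potential_norm V)\<^sup>2)) *
        (\<Sum>\<^sub>\<infinity>j. ennreal (exp (2 * \<beta> * real_of_int (j $ k1)) *
                ((cmod (u j 0))\<^sup>2 + (cmod (u j 1))\<^sup>2)))"
    (is "_ \<le> _ * ?R")
proof (cases "?R = \<infinity>")
  case True
  then show ?thesis by (simp add: ennreal_mult_top)
next
  case False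
  define m where "m = potential_norm V"
  have Vm: "cmod (V j s) \<le> m" if "s \<in> {0..1}" for j s
    unfolding m_def by (rule norm_le_potential_norm[OF V that])
  have m: "0 \<le> m"
    unfolding m_def by (rule potential_norm_nonneg[OF V])
  have eq: "lattice_equation V u"
    using u unfolding schroedinger_solution_def lattice_equation_def by blast
  have "(SUP t\<in>{0..1}. \<Sum>\<^sub>\<infinity>j. ennreal ((cmod (u j t))\<^sup>2)) < \<infinity>"
    using u unfolding schroedinger_solution_def by blast
  then obtain B where B: "0 \<le> B" "(SUP t\<in>{0..1}. \<Sum>\<^sub>\<infinity>j. ennreal ((cmod (u j t))\<^sup>2)) = ennreal B"
    by (cases "SUP t\<in>{0..1}. \<Sum>\<^sub>\<infinity>j. ennreal ((cmod (u j t))\<^sup>2)") auto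
  have uB: "(\<Sum>j\<in>A. (cmod (u j s))\<^sup>2) \<le> B" if "s \<in> {0..1}" "finite A" for s A
  proof -
    have "ennreal (\<Sum>j\<in>A. (cmod (u j s))\<^sup>2) \<le> (\<Sum>\<^sub>\<infinity>j. ennreal ((cmod (u j s))\<^sup>2))"
      by (rule sum_le_infsum_ennreal[OF that(2)]) simp
    also have "\<dots> \<le> ennreal B"
      unfolding B(2)[symmetric] by (rule SUP_upper[OF that(1)])
    finally show ?thesis using B(1) by simp
  qed
  define w where "w j = exp (2 * \<beta> * real_of_int (j $ k1))" for j :: "int ^ 'd"
  have sR: "(\<lambda>j. w j * ((cmod (u j 0))\<^sup>2 + (cmod (u j 1))\<^sup>2)) summable_on UNIV"
    using summable_on_if_infsum_ennreal_finite[OF False] by (simp add: w_def)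
  have s0: "(\<lambda>j. w j * (cmod (u j 0))\<^sup>2) summable_on UNIV"
    by (rule summable_on_comparison_test[OF sR]) (auto simp: w_def)
  define v where "v j t = of_real (exp (\<beta> * (j $ k1))) * u j t" for j t
  have v: "unif_sq_summable {0..1} v"
    unfolding v_def[abs_def]
    by (rule unif_sq_summable_exp_weight[OF eq Vm uB m s0[unfolded w_def]])
  have vw: "v j s \<bullet> v j s = w j * (cmod (u j s))\<^sup>2" for j s
    unfolding v_def w_def power2_norm_eq_inner[symmetric]
    by (simp add: norm_mult power_mult_distrib mult.assoc exp_double)
  have sum: "(\<lambda>j. w j * (cmod (u j s))\<^sup>2) summable_on UNIV" if "s \<in> {0..1}" for s
    using l2_inner_summable[OF v v that] by (simp add: vw)
  have inner: "l2_inner v v s = (\<Sum>\<^sub>\<infinity>j. w j * (cmod (u j s))\<^sup>2)" for s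
    unfolding l2_inner_def vw ..
  have "(\<Sum>\<^sub>\<infinity>j. ennreal (w j * (cmod (u j t))\<^sup>2)) = ennreal (l2_inner v v t)"
    unfolding inner by (rule infsum_ennreal[OF sum[OF t]]) (simp add: w_def)
  also have "\<dots> \<le> ennreal (exp (2 * m + m\<^sup>2) * (l2_inner v v 0 + l2_inner v v 1))"
    using exp_weight_convexity[OF eq Vm m _ t, of \<beta> k1] v
    unfolding v_def[abs_def] by (intro ennreal_leI) simp
  also have "l2_inner v v 0 + l2_inner v v 1 = (\<Sum>\<^sub>\<infinity>j. w j * ((cmod (u j 0))\<^sup>2 + (cmod (u j 1))\<^sup>2))"
    unfolding inner distrib_left by (rule infsum_add[symmetric]) (auto intro: sum)
  also have "ennreal (exp (2 * m + m\<^sup>2) * \<dots>) = ennreal (exp (2 * m + m\<^sup>2)) * ennreal \<dots>"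
    by (simp add: ennreal_mult')
  also have "ennreal (\<Sum>\<^sub>\<infinity>j. w j * ((cmod (u j 0))\<^sup>2 + (cmod (u j 1))\<^sup>2))
      = (\<Sum>\<^sub>\<infinity>j. ennreal (w j * ((cmod (u j 0))\<^sup>2 + (cmod (u j 1))\<^sup>2)))"
    by (rule infsum_ennreal[OF sR, symmetric]) (simp add: w_def)
  finally show ?thesis unfolding w_def m_def .
qed

text \<open>The convexity argument yields the exponent 2m + m^2 with m the norm of the potential. It
  becomes linear in m once m is at most \<open>M\<close>, with 2 + M as the constant, chosen before
  V, u, t and \<beta>.\<close>

theorem lemma3p1:
  fixes k1 :: "'d::finite" and M :: real
  shows "\<exists>C::real. \<forall>(V :: int ^ 'd \<Rightarrow> real \<Rightarrow> complex) (u :: int ^ 'd \<Rightarrow> real \<Rightarrow> complex).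
    bounded_potential V \<longrightarrow> potential_norm V \<le> M \<longrightarrow> schroedinger_solution V u \<longrightarrow>
    (\<forall>t\<in>{0..1}. \<forall>\<beta>::real.
      (\<Sum>\<^sub>\<infinity>j. ennreal (exp (2 * \<beta> * real_of_int (j $ k1)) * (cmod (u j t))\<^sup>2))
      \<le> ennreal (exp (C * potential_norm V)) *
        (\<Sum>\<^sub>\<infinity>j. ennreal (exp (2 * \<beta> * real_of_int (j $ k1)) *
                ((cmod (u j 0))\<^sup>2 + (cmod (u j 1))\<^sup>2))))"
proof (intro exI[of _ "2 + M"] allI impI ballI)
  fix V u :: "int ^ 'd \<Rightarrow> real \<Rightarrow> complex" and t \<beta> :: real
  assume V: "bounded_potential V" and M: "potential_norm V \<le> M"
    and u: "schroedinger_solution V u" and t: "t \<in> {0..1}"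
  have "2 * potential_norm V + (potential_norm V)\<^sup>2 \<le> (2 + M) * potential_norm V"
    using mult_right_mono[OF M potential_norm_nonneg[OF V]]
    by (simp add: power2_eq_square algebra_simps)
  then have "ennreal (exp (2 * potential_norm V + (potential_norm V)\<^sup>2))
      \<le> ennreal (exp ((2 + M) * potential_norm V))"
    by (simp add: ennreal_leI)
  from order_trans[OF exp_weighted_bound[OF V u t] mult_right_mono[OF this]]
  show "(\<Sum>\<^sub>\<infinity>j. ennreal (exp (2 * \<beta> * real_of_int (j $ k1)) * (cmod (u j t))\<^sup>2))
      \<le> ennreal (exp ((2 + M) * potential_norm V)) *
        (\<Sum>\<^sub>\<infinity>j. ennreal (exp (2 * \<beta> * real_of_int (j $ k1)) *
                ((cmod (u j 0))\<^sup>2 + (cmod (u j 1))\<^sup>2)))"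
    by simp
qed

end
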